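(* Assume condition (C) below holds. Then for every $\boldsymbol\theta\in\boldsymbol\Theta$, as $a,b\to\infty$, $$\mathrm E_{\boldsymbol\theta}[\hat T]\;\le\;(1+o(1))\max\left\{\frac{\log b}{I^0(\boldsymbol\theta)},\;\frac{\log a}{I^1(\boldsymbol\theta)}\right\},$$ where a term with denominator $+\infty$ is interpreted as $0$.
   Context: Setting: $K\ge1$ mutually independent data streams $\{X_k(n),n\ge1\}$, $k\in[K]$, each i.i.d. with density $f_{\theta_k}$ w.r.t. a $\sigma$-finite measure $\nu$, $\{f_\theta:\theta\in\Theta\}$ a parametric family, $\Theta=\Theta^0\cup\Theta^1$ with $\Theta^0,\Theta^1$ nonempty disjoint (noise/signal parameters). $I(\theta,\theta')=\int f_\theta\log(f_\theta/f_{\theta'})d\nu$; standing assumption $\inf_{\theta\in\Theta^1}I(\theta^0,\theta)>0$ for all $\theta^0\in\Theta^0$ and $\inf_{\theta\in\Theta^0}I(\theta^1,\theta)>0$ for all $\theta^1\in\Theta^1$. $\boldsymbol\Theta=\{\boldsymbol\theta\in\Theta^K:\exists\theta^0\in\Theta^0,\theta^1\in\Theta^1$ with $\theta_k=\theta^0$ whenever $\theta_k\in\Theta^0$ and $\theta_k=\theta^1$ whenever $\theta_k\in\Theta^1\}$. $\mathrm P_{\boldsymbol\theta},\mathrm E_{\boldsymbol\theta}$: stream $k$ has density $f_{\theta_k}$. $I(\boldsymbol\theta,\boldsymbol\theta')=\sum_kI(\theta_k,\theta_k')$. $A(\boldsymbol\theta)=\{k:\theta_k\in\Theta^1\}$.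 $I^0(\boldsymbol\theta)=\inf\{I(\boldsymbol\theta,\boldsymbol\theta'):\boldsymbol\theta'\in\boldsymbol\Theta, A(\boldsymbol\theta')\setminus A(\boldsymbol\theta)\ne\emptyset\}$, $I^1(\boldsymbol\theta)=\inf\{I(\boldsymbol\theta,\boldsymbol\theta'):\boldsymbol\theta'\in\boldsymbol\Theta, A(\boldsymbol\theta)\setminus A(\boldsymbol\theta')\ne\emptyset\}$, $\inf\emptyset=+\infty$. The procedure: $L_k(n;\theta)=\prod_{t=1}^nf_\theta(X_k(t))$; $\boldsymbol L(n;\boldsymbol\theta')=\prod_kL_k(n;\theta'_k)$; $L_k^i(n)=\sup_{\theta\in\Theta^i}L_k(n;\theta)$. $\hat\theta_k(n)\in\Theta$ is a (near-)MLE: $L_k(n;\hat\theta_k(n))\ge\sup_{\theta\in\Theta}L_k(n;\theta)-1/n$, $\hat\theta_k(0)\in\Theta$ arbitrary. $\hat{\boldsymbol L}(0)=1$, $\hat{\boldsymbol L}(n)=\hat{\boldsymbol L}(n-1)\prod_kf_{\hat\theta_k(n-1)}(X_k(n))$. $\hat A(n)=\{k:L_k^1(n)\ge L_k^0(n)\}$. $\boldsymbol L^0(n)=\sup\{\boldsymbol L(n;\boldsymbol\theta'):\boldsymbol\theta'\in\boldsymbol\Theta,A(\boldsymbol\theta')\setminus\hat A(n)\ne\emptyset\}$, $\boldsymbol L^1(n)=\sup\{\boldsymbol L(n;\boldsymbol\theta'):\boldsymbol\theta'\in\boldsymbol\Theta,\hat A(n)\setminus A(\boldsymbol\theta')\neq\emptyset\}$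 (sup of empty set is $0$, $x/0=+\infty$ for $x>0$). $\hat T=\inf\{n\ge1:\hat{\boldsymbol L}(n)/\boldsymbol L^0(n)\ge b\text{ and }\hat{\boldsymbol L}(n)/\boldsymbol L^1(n)\ge a\}$. Condition (C): for every $\boldsymbol\theta\in\boldsymbol\Theta$, $\epsilon>0$, $i\in\{0,1\}$: $\sum_{n\ge1}\mathrm P_{\boldsymbol\theta}\big(\tfrac1n\log\frac{\hat{\boldsymbol L}(n)}{\boldsymbol L^i(n)}\le I^i(\boldsymbol\theta)-\epsilon\big)<\infty$.
   Formalization: In condition (C), when I^i(θ)=+∞ (e.g. I^1 for all-noise θ) the event "≤ I^i−ε" would be the whole space, so (C) could never hold; it is read there as the event that the ratio L̂(n)/L^i(n) is finite. *)

theory Defs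
  imports "HOL-Probability.Probability"
begin

definition KL_integrand :: "('p \<Rightarrow> 'x \<Rightarrow> real) \<Rightarrow> 'p \<Rightarrow> 'p \<Rightarrow> 'x \<Rightarrow> ereal" where
  "KL_integrand f th th' x =
     (if f th x = 0 then 0
      else if f th' x = 0 then \<infinity>
      else ereal (f th x * ln (f th x / f th' x)))"

definition KL :: "'x measure \<Rightarrow> ('p \<Rightarrow> 'x \<Rightarrow> real) \<Rightarrow> 'p \<Rightarrow> 'p \<Rightarrow> ereal" where
  "KL \<nu> f th th' =
     enn2ereal (\<integral>\<^sup>+ x. e2ennreal (KL_integrand f th th' x) \<partial>\<nu>)
   - enn2ereal (\<integral>\<^sup>+ x. e2ennreal (- KL_integrand f th th' x) \<partial>\<nu>)"

definition Theta_bold :: "nat \<Rightarrow> 'p set \<Rightarrow> 'p set \<Rightarrow> (nat \<Rightarrow> 'p) set" where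
  "Theta_bold K \<Theta>0 \<Theta>1 =
     {th. (\<forall>k<K. th k \<in> \<Theta>0 \<union> \<Theta>1) \<and>
          (\<exists>t0\<in>\<Theta>0. \<exists>t1\<in>\<Theta>1. \<forall>k<K. (th k \<in> \<Theta>0 \<longrightarrow> th k = t0) \<and> (th k \<in> \<Theta>1 \<longrightarrow> th k = t1))}"

definition KLvec :: "nat \<Rightarrow> 'x measure \<Rightarrow> ('p \<Rightarrow> 'x \<Rightarrow> real) \<Rightarrow> (nat \<Rightarrow> 'p) \<Rightarrow> (nat \<Rightarrow> 'p) \<Rightarrow> ereal" where
  "KLvec K \<nu> f th th' = (\<Sum>k<K. KL \<nu> f (th k) (th' k))"

definition signal_set :: "nat \<Rightarrow> 'p set \<Rightarrow> (nat \<Rightarrow> 'p) \<Rightarrow> nat set" where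
  "signal_set K \<Theta>1 th = {k. k < K \<and> th k \<in> \<Theta>1}"

text \<open>I^0 and I^1 (Inf of the empty set of ereals is +infinity).\<close>
definition I0 :: "nat \<Rightarrow> 'x measure \<Rightarrow> ('p \<Rightarrow> 'x \<Rightarrow> real) \<Rightarrow> 'p set \<Rightarrow> 'p set \<Rightarrow> (nat \<Rightarrow> 'p) \<Rightarrow> ereal" where
  "I0 K \<nu> f \<Theta>0 \<Theta>1 th = Inf {KLvec K \<nu> f th th' | th'. th' \<in> Theta_bold K \<Theta>0 \<Theta>1 \<and>
                                  signal_set K \<Theta>1 th' - signal_set K \<Theta>1 th \<noteq> {}}"

definition I1 :: "nat \<Rightarrow> 'x measure \<Rightarrow> ('p \<Rightarrow> 'x \<Rightarrow> real) \<Rightarrow> 'p set \<Rightarrow> 'p set \<Rightarrow> (nat \<Rightarrow> 'p) \<Rightarrow> ereal" where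
  "I1 K \<nu> f \<Theta>0 \<Theta>1 th = Inf {KLvec K \<nu> f th th' | th'. th' \<in> Theta_bold K \<Theta>0 \<Theta>1 \<and>
                                  signal_set K \<Theta>1 th - signal_set K \<Theta>1 th' \<noteq> {}}"

text \<open>A sample point is omega :: nat \<times> nat \<Rightarrow> 'x with X_k(t) = omega (k,t); the streams
  k < K are independent, each i.i.d. with density f (th k) w.r.t. nu.
  (Coordinates with t = 0 are present but unused.)\<close>
definition Pth :: "nat \<Rightarrow> 'x measure \<Rightarrow> ('p \<Rightarrow> 'x \<Rightarrow> real) \<Rightarrow> (nat \<Rightarrow> 'p) \<Rightarrow> (nat \<times> nat \<Rightarrow> 'x) measure" where
  "Pth K \<nu> f th = PiM ({..<K} \<times> UNIV) (\<lambda>(k,t). density \<nu> (\<lambda>x. ennreal (f (th k) x)))"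

definition stream :: "(nat \<times> nat \<Rightarrow> 'x) \<Rightarrow> nat \<Rightarrow> nat \<Rightarrow> 'x" where
  "stream \<omega> k = (\<lambda>t. \<omega> (k, t))"

definition Lik :: "('p \<Rightarrow> 'x \<Rightarrow> real) \<Rightarrow> nat \<Rightarrow> nat \<Rightarrow> 'p \<Rightarrow> (nat \<times> nat \<Rightarrow> 'x) \<Rightarrow> real" where
  "Lik f k n th \<omega> = (\<Prod>t\<in>{1..n}. f th (\<omega> (k, t)))"

definition Lik_sup :: "'p set \<Rightarrow> ('p \<Rightarrow> 'x \<Rightarrow> real) \<Rightarrow> nat \<Rightarrow> nat \<Rightarrow> (nat \<times> nat \<Rightarrow> 'x) \<Rightarrow> ennreal" where
  "Lik_sup \<Theta>i f k n \<omega> = (SUP th\<in>\<Theta>i. ennreal (Lik f k n th \<omega>))"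

definition Ahat :: "nat \<Rightarrow> ('p \<Rightarrow> 'x \<Rightarrow> real) \<Rightarrow> 'p set \<Rightarrow> 'p set \<Rightarrow> nat \<Rightarrow> (nat \<times> nat \<Rightarrow> 'x) \<Rightarrow> nat set" where
  "Ahat K f \<Theta>0 \<Theta>1 n \<omega> = {k. k < K \<and> Lik_sup \<Theta>1 f k n \<omega> \<ge> Lik_sup \<Theta>0 f k n \<omega>}"

definition Lvec :: "nat \<Rightarrow> ('p \<Rightarrow> 'x \<Rightarrow> real) \<Rightarrow> nat \<Rightarrow> (nat \<Rightarrow> 'p) \<Rightarrow> (nat \<times> nat \<Rightarrow> 'x) \<Rightarrow> real" where
  "Lvec K f n th \<omega> = (\<Prod>k<K. Lik f k n (th k) \<omega>)"

text \<open>bold L^0(n), bold L^1(n); the sup of the empty set in ennreal is 0.\<close>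
definition Lbold0 :: "nat \<Rightarrow> ('p \<Rightarrow> 'x \<Rightarrow> real) \<Rightarrow> 'p set \<Rightarrow> 'p set \<Rightarrow> nat \<Rightarrow> (nat \<times> nat \<Rightarrow> 'x) \<Rightarrow> ennreal" where
  "Lbold0 K f \<Theta>0 \<Theta>1 n \<omega> =
     (SUP th'\<in>{th' \<in> Theta_bold K \<Theta>0 \<Theta>1. signal_set K \<Theta>1 th' - Ahat K f \<Theta>0 \<Theta>1 n \<omega> \<noteq> {}}.
        ennreal (Lvec K f n th' \<omega>))"

definition Lbold1 :: "nat \<Rightarrow> ('p \<Rightarrow> 'x \<Rightarrow> real) \<Rightarrow> 'p set \<Rightarrow> 'p set \<Rightarrow> nat \<Rightarrow> (nat \<times> nat \<Rightarrow> 'x) \<Rightarrow> ennreal" where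
  "Lbold1 K f \<Theta>0 \<Theta>1 n \<omega> =
     (SUP th'\<in>{th' \<in> Theta_bold K \<Theta>0 \<Theta>1. Ahat K f \<Theta>0 \<Theta>1 n \<omega> - signal_set K \<Theta>1 th' \<noteq> {}}.
        ennreal (Lvec K f n th' \<omega>))"

text \<open>Estimator thetahat k n is a function of the k-th stream (it is required below to depend
  only on its first n observations). hat L(n) = prod_{t=1..n} prod_k f_{thetahat_k(t-1)}(X_k(t)).\<close>
definition Lhat :: "nat \<Rightarrow> ('p \<Rightarrow> 'x \<Rightarrow> real) \<Rightarrow> (nat \<Rightarrow> nat \<Rightarrow> (nat \<Rightarrow> 'x) \<Rightarrow> 'p) \<Rightarrow> nat
                     \<Rightarrow> (nat \<times> nat \<Rightarrow> 'x) \<Rightarrow> ennreal" where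
  "Lhat K f thhat n \<omega> =
     ennreal (\<Prod>t\<in>{1..n}. \<Prod>k<K. f (thhat k (t - 1) (stream \<omega> k)) (\<omega> (k, t)))"

definition near_MLE :: "nat \<Rightarrow> ('p \<Rightarrow> 'x \<Rightarrow> real) \<Rightarrow> 'p set \<Rightarrow> 'p set
                         \<Rightarrow> (nat \<Rightarrow> nat \<Rightarrow> (nat \<Rightarrow> 'x) \<Rightarrow> 'p) \<Rightarrow> bool" where
  "near_MLE K f \<Theta>0 \<Theta>1 thhat \<longleftrightarrow>
     (\<forall>k<K. \<forall>n x. thhat k n x \<in> \<Theta>0 \<union> \<Theta>1) \<and>
     (\<forall>k<K. \<forall>n x y. (\<forall>t\<in>{1..n}. x t = y t) \<longrightarrow> thhat k n x = thhat k n y) \<and>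
     (\<forall>k<K. \<forall>n\<ge>1. \<forall>x.
        ennreal (\<Prod>t\<in>{1..n}. f (thhat k n x) (x t))
          \<ge> (SUP th\<in>\<Theta>0 \<union> \<Theta>1. ennreal (\<Prod>t\<in>{1..n}. f th (x t))) - ennreal (1 / real n))"

text \<open>Stopping time hat T (value +infinity if the stopping set is empty). Ratios in ennreal:
  x/0 = infinity for x > 0.\<close>
definition stop_cond :: "nat \<Rightarrow> ('p \<Rightarrow> 'x \<Rightarrow> real) \<Rightarrow> 'p set \<Rightarrow> 'p set
                         \<Rightarrow> (nat \<Rightarrow> nat \<Rightarrow> (nat \<Rightarrow> 'x) \<Rightarrow> 'p) \<Rightarrow> real \<Rightarrow> real \<Rightarrow> nat \<Rightarrow> (nat \<times> nat \<Rightarrow> 'x) \<Rightarrow> bool" where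
  "stop_cond K f \<Theta>0 \<Theta>1 thhat a b n \<omega> \<longleftrightarrow>
     ennreal b \<le> Lhat K f thhat n \<omega> / Lbold0 K f \<Theta>0 \<Theta>1 n \<omega> \<and>
     ennreal a \<le> Lhat K f thhat n \<omega> / Lbold1 K f \<Theta>0 \<Theta>1 n \<omega>"

definition That :: "nat \<Rightarrow> ('p \<Rightarrow> 'x \<Rightarrow> real) \<Rightarrow> 'p set \<Rightarrow> 'p set
                     \<Rightarrow> (nat \<Rightarrow> nat \<Rightarrow> (nat \<Rightarrow> 'x) \<Rightarrow> 'p) \<Rightarrow> real \<Rightarrow> real \<Rightarrow> (nat \<times> nat \<Rightarrow> 'x) \<Rightarrow> ennreal" where
  "That K f \<Theta>0 \<Theta>1 thhat a b \<omega> =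
     (if \<exists>n\<ge>1. stop_cond K f \<Theta>0 \<Theta>1 thhat a b n \<omega>
      then of_nat (LEAST n. n \<ge> 1 \<and> stop_cond K f \<Theta>0 \<Theta>1 thhat a b n \<omega>)
      else \<infinity>)"

definition C_event :: "'a measure \<Rightarrow> ereal \<Rightarrow> real \<Rightarrow> nat \<Rightarrow> ('a \<Rightarrow> ennreal) \<Rightarrow> 'a set" where
  "C_event M Istar \<epsilon> n R =
     {\<omega> \<in> space M. if Istar = \<infinity> then R \<omega> \<noteq> \<top>
                   else R \<omega> \<le> ennreal (exp (real n * (real_of_ereal Istar - \<epsilon>)))}"

definition cond_C :: "nat \<Rightarrow> 'x measure \<Rightarrow> ('p \<Rightarrow> 'x \<Rightarrow> real) \<Rightarrow> 'p set \<Rightarrow> 'p set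
                      \<Rightarrow> (nat \<Rightarrow> nat \<Rightarrow> (nat \<Rightarrow> 'x) \<Rightarrow> 'p) \<Rightarrow> bool" where
  "cond_C K \<nu> f \<Theta>0 \<Theta>1 thhat \<longleftrightarrow>
     (\<forall>th\<in>Theta_bold K \<Theta>0 \<Theta>1. \<forall>\<epsilon>>0.
        summable (\<lambda>n. measure (Pth K \<nu> f th)
          (C_event (Pth K \<nu> f th) (I0 K \<nu> f \<Theta>0 \<Theta>1 th) \<epsilon> (Suc n)
             (\<lambda>\<omega>. Lhat K f thhat (Suc n) \<omega> / Lbold0 K f \<Theta>0 \<Theta>1 (Suc n) \<omega>))) \<and>
        summable (\<lambda>n. measure (Pth K \<nu> f th)
          (C_event (Pth K \<nu> f th) (I1 K \<nu> f \<Theta>0 \<Theta>1 th) \<epsilon> (Suc n)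
             (\<lambda>\<omega>. Lhat K f thhat (Suc n) \<omega> / Lbold1 K f \<Theta>0 \<Theta>1 (Suc n) \<omega>))))"

definition div_inf :: "real \<Rightarrow> ereal \<Rightarrow> real" where
  "div_inf x I = (if I = \<infinity> then 0 else x / real_of_ereal I)"

end

theory Submission
  imports Defs
begin

text \<open>
  Outside the events of condition (C) the stopping rule is met as soon as \<open>n\<close> exceeds
  \<open>1 + \<epsilon> / 2\<close> times the maximum in the bound, so the stopping time is at most that threshold plus
  the number of bad events that occur, whose expectation is finite.

  The delicate case is \<open>I\<^sup>0(\<theta>) = I\<^sup>1(\<theta>) = \<infinity>\<close>, where the bound reads \<open>E T \<le> 0\<close>; it has to be shown
  to contradict condition (C).  By (C) the plug-in likelihood never vanishes, so the initial
  estimate \<open>d\<close> dominates every \<open>f\<^sub>\<theta>\<close>, and every later estimate almost surely lies in the set \<open>D\<close>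
  of parameters whose density is positive \<open>d\<close>-almost everywhere.  If \<open>D\<close> met both hypotheses,
  one of the two competing suprema would stay positive under \<open>\<theta>\<close>.  So \<open>D\<close> lies on one side,
  say noise; let all streams follow a signal parameter \<open>p\<close>.  Every step of the plug-in
  likelihood then loses at least \<open>J = inf I(p, \<theta>\<^sub>0)\<close> on average, while some competitor on the noise
  side loses hardly more than \<open>J\<close>; yet (C) makes the plug-in likelihood exceed that competitor
  exponentially, up to events of summable probability.  Convergence of these probabilities to
  zero alone would not be contradictory, their summability is.
\<close>

section \<open>Resampling coordinates of product measures\<close>

text \<open>The contradiction comes from a walk: the log ratio of a competitor to the plug-in
  likelihood. Its steps are dependent, since the estimates change with the data, and an upward step
  may have infinite mean, since a divergence may be infinite; so no law of large numbers is invoked.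
  What is available is that the negative part of a log-likelihood ratio has mean at most 1. Together
  with the finite divergence of the competitor this bounds the mean of a downward step given the
  past. Mean inequalities are therefore kept in \<open>ennreal\<close> as sums, and only finite
  terms are cancelled. Conditioning on the past is realised by redrawing all later coordinates from
  an independent copy, that is, by Tonelli on a product of two product measures. The same device
  lets past and future follow different parameters, which is how an estimate computed from data
  under one parameter is tested on observations from \<open>d\<close>.\<close>

definition resample :: "'i set \<Rightarrow> ('i \<Rightarrow> 'a) \<Rightarrow> ('i \<Rightarrow> 'a) \<Rightarrow> 'i \<Rightarrow> 'a" where
  "resample S \<omega> \<omega>' i = (if i \<in> S then \<omega>' i else \<omega> i)"

lemma measurable_resample:
  assumes "\<And>i. i \<in> I \<Longrightarrow> sets (Q i) = sets (N i)" "\<And>i. i \<in> I \<Longrightarrow> sets (Q' i) = sets (N i)"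
  shows "(\<lambda>(\<omega>, \<omega>'). resample S \<omega> \<omega>') \<in> measurable (PiM I Q \<Otimes>\<^sub>M PiM I Q') (PiM I N)"
proof -
  have Q: "sets (PiM I Q) = sets (PiM I N)" "sets (PiM I Q') = sets (PiM I N)"
    by (auto intro!: sets_PiM_cong simp: assms)
  have "(\<lambda>p. resample S (fst p) (snd p)) \<in> measurable (PiM I N \<Otimes>\<^sub>M PiM I N) (PiM I N)"
  proof (rule measurable_PiM_single')
    fix i assume i: "i \<in> I"
    show "(\<lambda>p. resample S (fst p) (snd p) i) \<in> measurable (PiM I N \<Otimes>\<^sub>M PiM I N) (N i)"
      using i by (cases "i \<in> S") (simp_all add: resample_def)
  next
    show "(\<lambda>p. resample S (fst p) (snd p)) \<in> space (PiM I N \<Otimes>\<^sub>M PiM I N) \<rightarrow> (\<Pi>\<^sub>E i\<in>I. space (N i))"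
      by (auto simp: resample_def space_pair_measure space_PiM PiE_iff extensional_def)
  qed
  moreover have "sets (PiM I Q \<Otimes>\<^sub>M PiM I Q') = sets (PiM I N \<Otimes>\<^sub>M PiM I N)"
    using Q by (intro sets_pair_measure_cong)
  ultimately show ?thesis
    by (simp add: case_prod_beta' cong: measurable_cong_sets)
qed

text \<open>The preimage of a cylinder over \<open>J\<close> is a rectangle, a cylinder over
  \<open>J - S\<close> times one over \<open>J \<inter> S\<close>, so its mass factors; and
  cylinders determine a finite measure on an infinite product.\<close>

lemma distr_resample_PiM:
  assumes Q: "\<And>i. i \<in> I \<Longrightarrow> prob_space (Q i)" and Q': "\<And>i. i \<in> I \<Longrightarrow> prob_space (Q' i)"
    and s: "\<And>i. i \<in> I \<Longrightarrow> sets (Q' i) = sets (Q i)"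
  shows "distr (PiM I Q \<Otimes>\<^sub>M PiM I Q') (PiM I Q) (\<lambda>(\<omega>, \<omega>'). resample S \<omega> \<omega>')
       = PiM I (\<lambda>i. if i \<in> S then Q' i else Q i)"
    (is "?D = PiM I ?R")
proof (rule measure_eqI_PiM_infinite[symmetric, OF refl])
  interpret A: prob_space "PiM I Q" using Q by (rule prob_space_PiM)
  interpret B: prob_space "PiM I Q'" using Q' by (rule prob_space_PiM)
  have R: "prob_space (?R i)" if "i \<in> I" for i using that Q Q' by auto
  have sR: "sets (PiM I Q) = sets (PiM I ?R)" using s by (intro sets_PiM_cong) auto
  show "sets ?D = sets (PiM I ?R)" using sR by simp
  interpret R: prob_space "PiM I ?R" using R by (rule prob_space_PiM)
  show "finite_measure (PiM I ?R)" by unfold_locales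
  fix J A assume J: "finite J" "J \<subseteq> I" and A: "\<And>i. i \<in> J \<Longrightarrow> A i \<in> sets (?R i)"
  have AQ: "A i \<in> sets (Q i)" "A i \<in> sets (Q' i)" if "i \<in> J" for i
    using A[OF that] s[of i] that J by (auto split: if_splits)
  let ?X = "prod_emb I ?R J (Pi\<^sub>E J A)"
  let ?E = "prod_emb I Q (J - S) (Pi\<^sub>E (J - S) A)"
  let ?F = "prod_emb I Q' (J \<inter> S) (Pi\<^sub>E (J \<inter> S) A)"
  have X: "?X \<in> sets (PiM I Q)"
    unfolding sR using J A by (intro sets_PiM_I) auto
  have sp: "space (Q' i) = space (Q i)" "space (?R i) = space (Q i)" if "i \<in> I" for i
    using sets_eq_imp_space_eq[OF s[OF that]] by auto
  have "(\<lambda>(\<omega>, \<omega>'). resample S \<omega> \<omega>') -` ?X \<inter> space (PiM I Q \<Otimes>\<^sub>M PiM I Q') = ?E \<times> ?F" (is "?L = _")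
  proof -
    have "(w, v) \<in> ?L \<longleftrightarrow> (w, v) \<in> ?E \<times> ?F" for w v
    proof -
      have "(w, v) \<in> ?L \<longleftrightarrow> w \<in> space (PiM I Q) \<and> v \<in> space (PiM I Q') \<and> (\<forall>i\<in>J. resample S w v i \<in> A i)"
      proof -
        have "resample S w v \<in> (\<Pi>\<^sub>E i\<in>I. space (?R i))"
          if "w \<in> space (PiM I Q)" "v \<in> space (PiM I Q')"
          using that sp by (auto simp: space_PiM PiE_iff resample_def extensional_def)
        then show ?thesis
          by (auto simp: prod_emb_def space_pair_measure restrict_PiE_iff)
      qed
      also have "\<dots> \<longleftrightarrow> (w, v) \<in> ?E \<times> ?F"
        by (auto simp: prod_emb_def space_PiM PiE_iff restrict_def extensional_def resample_def
              split: if_splits)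
      finally show ?thesis .
    qed
    then show ?thesis by (intro set_eqI) (simp only: split_paired_all)
  qed
  then have "emeasure ?D ?X = emeasure (PiM I Q \<Otimes>\<^sub>M PiM I Q') (?E \<times> ?F)"
    using X measurable_resample[of I Q Q Q' S] s by (subst emeasure_distr) auto
  also have "\<dots> = emeasure (PiM I Q) ?E * emeasure (PiM I Q') ?F"
    using J AQ by (intro B.emeasure_pair_measure_Times) (auto intro!: sets_PiM_I)
  also have "\<dots> = (\<Prod>i\<in>J - S. emeasure (Q i) (A i)) * (\<Prod>i\<in>J \<inter> S. emeasure (Q' i) (A i))"
    using J AQ Q Q' by (intro arg_cong2[where f="(*)"] emeasure_PiM_emb) auto
  also have "\<dots> = (\<Prod>i\<in>J - S. emeasure (?R i) (A i)) * (\<Prod>i\<in>J \<inter> S. emeasure (?R i) (A i))"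
    by (intro arg_cong2[where f="(*)"] prod.cong) auto
  also have "\<dots> = (\<Prod>i\<in>(J - S) \<union> (J \<inter> S). emeasure (?R i) (A i))"
    using J by (intro prod.union_disjoint[symmetric]) auto
  also have "(J - S) \<union> (J \<inter> S) = J" by auto
  also have "(\<Prod>i\<in>J. emeasure (?R i) (A i)) = emeasure (PiM I ?R) ?X"
    using J A R by (intro emeasure_PiM_emb[symmetric]) auto
  finally show "emeasure (PiM I ?R) ?X = emeasure ?D ?X" ..
qed

text \<open>Tonelli along \<open>distr_resample_PiM\<close>. With \<open>Q' = Q\<close> it splits an
  expectation at a set of coordinates; with another \<open>Q'\<close> it describes a sample whose
  coordinates in \<open>S\<close> follow a different law.\<close>

lemma
  assumes Q: "\<And>i. i \<in> I \<Longrightarrow> prob_space (Q i)" and Q': "\<And>i. i \<in> I \<Longrightarrow> prob_space (Q' i)"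
    and s: "\<And>i. i \<in> I \<Longrightarrow> sets (Q' i) = sets (Q i)"
  shows nn_integral_resample:
    "g \<in> borel_measurable (PiM I Q) \<Longrightarrow>
      (\<integral>\<^sup>+ \<omega>. g \<omega> \<partial>PiM I (\<lambda>i. if i \<in> S then Q' i else Q i))
        = (\<integral>\<^sup>+ \<omega>. (\<integral>\<^sup>+ \<omega>'. g (resample S \<omega> \<omega>') \<partial>PiM I Q') \<partial>PiM I Q)"
  and AE_resample:
    "AE \<omega> in PiM I (\<lambda>i. if i \<in> S then Q' i else Q i). P \<omega> \<Longrightarrow>
      AE \<omega> in PiM I Q. AE \<omega>' in PiM I Q'. P (resample S \<omega> \<omega>')"
proof -
  interpret A: prob_space "PiM I Q" using Q by (rule prob_space_PiM)
  interpret B: prob_space "PiM I Q'" using Q' by (rule prob_space_PiM)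
  interpret AB: pair_sigma_finite "PiM I Q" "PiM I Q'" ..
  have m: "(\<lambda>(\<omega>, \<omega>'). resample S \<omega> \<omega>') \<in> measurable (PiM I Q \<Otimes>\<^sub>M PiM I Q') (PiM I Q)"
    using s by (intro measurable_resample) auto
  have D: "PiM I (\<lambda>i. if i \<in> S then Q' i else Q i)
      = distr (PiM I Q \<Otimes>\<^sub>M PiM I Q') (PiM I Q) (\<lambda>(\<omega>, \<omega>'). resample S \<omega> \<omega>')"
    using Q Q' s by (intro distr_resample_PiM[symmetric]) auto
  {
    assume g: "g \<in> borel_measurable (PiM I Q)"
    have "(\<integral>\<^sup>+ \<omega>. g \<omega> \<partial>PiM I (\<lambda>i. if i \<in> S then Q' i else Q i))
        = (\<integral>\<^sup>+ p. g ((\<lambda>(\<omega>, \<omega>'). resample S \<omega> \<omega>') p) \<partial>(PiM I Q \<Otimes>\<^sub>M PiM I Q'))"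
      unfolding D using g by (intro nn_integral_distr[OF m]) simp
    also have "\<dots> = (\<integral>\<^sup>+ \<omega>. (\<integral>\<^sup>+ \<omega>'. g (resample S \<omega> \<omega>') \<partial>PiM I Q') \<partial>PiM I Q)"
      using measurable_compose[OF m g] by (subst B.nn_integral_fst[symmetric]) (auto simp: case_prod_beta')
    finally show "(\<integral>\<^sup>+ \<omega>. g \<omega> \<partial>PiM I (\<lambda>i. if i \<in> S then Q' i else Q i))
        = (\<integral>\<^sup>+ \<omega>. (\<integral>\<^sup>+ \<omega>'. g (resample S \<omega> \<omega>') \<partial>PiM I Q') \<partial>PiM I Q)" .
  }
  assume "AE \<omega> in PiM I (\<lambda>i. if i \<in> S then Q' i else Q i). P \<omega>"
  then have "AE p in PiM I Q \<Otimes>\<^sub>M PiM I Q'. P ((\<lambda>(\<omega>, \<omega>'). resample S \<omega> \<omega>') p)"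
    unfolding D by (rule AE_distrD[OF m])
  then have "AE p in PiM I Q \<Otimes>\<^sub>M PiM I Q'. P (resample S (fst p) (snd p))"
    by (simp add: case_prod_beta')
  from AB.AE_pair[OF this] show "AE \<omega> in PiM I Q. AE \<omega>' in PiM I Q'. P (resample S \<omega> \<omega>')"
    by simp
qed

text \<open>Finiteness of \<open>S\<close> matters: infinite products of mutually absolutely
  continuous factors can be mutually singular (Kakutani). One coordinate is changed at a time: by
  Tonelli almost every section in direction \<open>j\<close> is null for the old factor, hence for
  \<open>Q' j\<close>.\<close>

lemma AE_PiM_finite_change:
  assumes Q: "\<And>i. i \<in> I \<Longrightarrow> prob_space (Q i)" and Q': "\<And>i. i \<in> I \<Longrightarrow> prob_space (Q' i)"
    and s: "\<And>i. i \<in> I \<Longrightarrow> sets (Q' i) = sets (Q i)"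
    and ac: "\<And>i. i \<in> I \<Longrightarrow> absolutely_continuous (Q i) (Q' i)"
    and S: "finite S" "S \<subseteq> I"
    and P: "AE \<omega> in PiM I Q. P \<omega>"
  shows "AE \<omega> in PiM I (\<lambda>i. if i \<in> S then Q' i else Q i). P \<omega>"
  using S
proof (induction S rule: finite_induct)
  case empty
  have "PiM I (\<lambda>i. if i \<in> {} then Q' i else Q i) = PiM I Q" by (intro PiM_cong) auto
  then show ?case using P by (simp only:)
next
  case (insert j F)
  let ?R = "\<lambda>i. if i \<in> F then Q' i else Q i"
  let ?R' = "\<lambda>i. if i \<in> {j} then Q' i else ?R i"
  have R: "\<And>i. i \<in> I \<Longrightarrow> prob_space (?R i)" "\<And>i. i \<in> I \<Longrightarrow> sets (?R i) = sets (Q i)"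
    using Q Q' s by auto
  have sR: "\<And>i. i \<in> I \<Longrightarrow> sets (Q' i) = sets (?R i)" using s by auto
  have R': "(\<lambda>i. if i \<in> insert j F then Q' i else Q i) = ?R'" by auto
  \<comment> \<open>\<open>P\<close> need not be measurable, so the argument runs with a measurable
    null set that covers its failures.\<close>
  from insert obtain B where B: "B \<in> sets (PiM I ?R)" "emeasure (PiM I ?R) B = 0"
    "{\<omega> \<in> space (PiM I ?R). \<not> P \<omega>} \<subseteq> B" by (auto elim: AE_E)
  have ne: "AE \<omega> in PiM I ?R. \<omega> \<notin> B" using B by (auto intro!: AE_not_in null_setsI)
  \<comment> \<open>Redrawing coordinate \<open>j\<close> from its own law changes nothing in law,
    but exposes the sections in direction \<open>j\<close>.\<close>
  have "AE \<omega> in PiM I (\<lambda>i. if i \<in> {j} then ?R i else ?R i). \<omega> \<notin> B"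
    using ne by (simp only: if_cancel)
  from AE_resample[OF R(1) R(1) refl this]
  have *: "AE \<omega> in PiM I ?R. AE \<omega>' in PiM I ?R. resample {j} \<omega> \<omega>' \<notin> B" .
  have "AE \<omega> in PiM I ?R. AE \<omega>' in PiM I Q'. resample {j} \<omega> \<omega>' \<notin> B"
  proof (rule AE_mp[OF *], rule AE_I2, rule impI)
    fix \<omega> assume w: "\<omega> \<in> space (PiM I ?R)" and a: "AE \<omega>' in PiM I ?R. resample {j} \<omega> \<omega>' \<notin> B"
    have jI: "j \<in> I" using insert by auto
    have upd: "resample {j} \<omega> \<omega>' = fun_upd \<omega> j (\<omega>' j)" for \<omega>' by (auto simp: resample_def)
    have m: "(\<lambda>x. fun_upd \<omega> j x) \<in> measurable (?R j) (PiM I ?R)"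
    proof (rule measurable_PiM_single')
      fix i assume "i \<in> I"
      then show "(\<lambda>x. fun_upd \<omega> j x i) \<in> measurable (?R j) (?R i)"
        using w by (cases "i = j") (auto simp: space_PiM PiE_iff)
    qed (use w jI in \<open>auto simp: space_PiM PiE_iff extensional_def\<close>)
    have "{x \<in> space (?R j). fun_upd \<omega> j x \<notin> B}
        = (\<lambda>x. fun_upd \<omega> j x) -` (space (PiM I ?R) - B) \<inter> space (?R j)"
      using measurable_space[OF m] by blast
    then have Bm: "{x \<in> space (?R j). fun_upd \<omega> j x \<notin> B} \<in> sets (?R j)"
      using measurable_sets[OF m, of "space (PiM I ?R) - B"] B(1) by (simp only: sets.compl_sets)
    have d: "distr (PiM I ?R) (?R j) (\<lambda>w. w j) = ?R j"
      using R(1) jI by (intro distr_PiM_component)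
    have "AE x in distr (PiM I ?R) (?R j) (\<lambda>w. w j). fun_upd \<omega> j x \<notin> B"
      using a Bm jI by (subst AE_distr_iff) (simp_all add: upd)
    then have "AE x in ?R j. fun_upd \<omega> j x \<notin> B" unfolding d .
    then have "AE x in Q j. fun_upd \<omega> j x \<notin> B" using insert(2) by (simp only: if_False)
    then have "AE x in Q' j. fun_upd \<omega> j x \<notin> B"
      using ac[OF jI] s[OF jI] absolutely_continuous_AE by blast
    then have "AE w in PiM I Q'. fun_upd \<omega> j (w j) \<notin> B"
      using Q' jI by (intro AE_PiM_component)
    then show "AE \<omega>' in PiM I Q'. resample {j} \<omega> \<omega>' \<notin> B" by (simp add: upd)
  qed
  note ** = this
  have "AE \<omega> in PiM I ?R. (\<integral>\<^sup>+ \<omega>'. indicator B (resample {j} \<omega> \<omega>') \<partial>PiM I Q') = (0::ennreal)"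
  proof (rule AE_mp[OF **], rule AE_I2, rule impI)
    fix \<omega> assume a: "AE \<omega>' in PiM I Q'. resample {j} \<omega> \<omega>' \<notin> B"
    have "(\<integral>\<^sup>+ \<omega>'. indicator B (resample {j} \<omega> \<omega>') \<partial>PiM I Q') = (\<integral>\<^sup>+ \<omega>'. (0::ennreal) \<partial>PiM I Q')"
      using a by (intro nn_integral_cong_AE) (auto elim!: AE_mp)
    then show "(\<integral>\<^sup>+ \<omega>'. indicator B (resample {j} \<omega> \<omega>') \<partial>PiM I Q') = (0::ennreal)" by simp
  qed
  then have "(\<integral>\<^sup>+ \<omega>. (\<integral>\<^sup>+ \<omega>'. indicator B (resample {j} \<omega> \<omega>') \<partial>PiM I Q') \<partial>PiM I ?R) = (0::ennreal)"
    by (subst nn_integral_cong_AE[where v="\<lambda>_. 0"]) auto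
  moreover have "(\<integral>\<^sup>+ \<omega>. indicator B \<omega> \<partial>PiM I ?R')
      = (\<integral>\<^sup>+ \<omega>. (\<integral>\<^sup>+ \<omega>'. indicator B (resample {j} \<omega> \<omega>') \<partial>PiM I Q') \<partial>PiM I ?R)"
    by (rule nn_integral_resample[OF R(1) Q' sR]) (use B in auto)
  moreover have sP: "sets (PiM I ?R') = sets (PiM I ?R)" using s by (intro sets_PiM_cong) auto
  ultimately have "emeasure (PiM I ?R') B = 0" using B by simp
  then have "AE \<omega> in PiM I ?R'. \<omega> \<notin> B" using B sP by (auto intro!: AE_not_in null_setsI)
  then show ?case unfolding R'
    by (rule AE_mp) (use B sets_eq_imp_space_eq[OF sP] in \<open>auto intro!: AE_I2\<close>)
qed

section \<open>Processes with bounded expected decrease\<close>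

text \<open>Layer-cake bound with step \<open>c\<close>: for \<open>w > 0\<close> the indicators
  count the levels \<open>m * c\<close> below \<open>w\<close>, and there are at least
  \<open>w / c\<close> of them.\<close>

lemma ennreal_le_suminf_indicator:
  fixes w c :: real
  assumes "c > 0"
  shows "ennreal w \<le> ennreal c * (\<Sum>m. indicator {y. y > real m * c} w)"
proof (cases "w > 0")
  case True
  define q where "q = nat \<lceil>w / c\<rceil>"
  have q: "real q \<ge> w / c" unfolding q_def by linarith
  have "real m * c < w" if "m < q" for m
  proof -
    have "real m < w / c" using that unfolding q_def by linarith
    then show ?thesis using assms by (simp add: field_simps)
  qed
  then have "(\<Sum>m<q. indicator {y. y > real m * c} w) = (\<Sum>m<q. 1 :: ennreal)"
    by (intro sum.cong) (auto simp: indicator_def)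
  then have "of_nat q \<le> (\<Sum>m. indicator {y. y > real m * c} w :: ennreal)"
    using sum_le_suminf[of "\<lambda>m. indicator {y. y > real m * c} w :: ennreal" "{..<q}"] by simp
  then have "ennreal c * of_nat q \<le> ennreal c * (\<Sum>m. indicator {y. y > real m * c} w)"
    by (intro mult_left_mono) auto
  moreover have "ennreal w \<le> ennreal c * of_nat q"
    using q assms by (simp add: ennreal_of_nat_eq_real_of_nat ennreal_mult'[symmetric] field_simps)
  ultimately show ?thesis by (rule order_trans[rotated])
qed (simp add: ennreal_neg)

text \<open>\<open>ennreal\<close> truncates at 0, so the left side is a sum of positive parts, not
  the positive part of a sum.\<close>

lemma sum_ennreal_max: "(\<Sum>t\<in>A. ennreal (g t)) = ennreal (\<Sum>t\<in>A. max 0 (g t))"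
proof -
  have "ennreal (g t) = ennreal (max 0 (g t))" for t by (simp add: max_def ennreal_neg)
  then have "(\<Sum>t\<in>A. ennreal (g t)) = (\<Sum>t\<in>A. ennreal (max 0 (g t)))" by (intro sum.cong) auto
  also have "\<dots> = ennreal (\<Sum>t\<in>A. max 0 (g t))" by (intro sum_ennreal) auto
  finally show ?thesis .
qed

text \<open>An excursion of height \<open>w\<close> above the line of slope \<open>-\<kappa>\<close> lasts, with probability at
  least one half, about \<open>w / (2 * C)\<close> steps, since the walk falls by at most \<open>C\<close> per step on
  average.  So the expected number of times spent above the line bounds the expected height at
  every time \<open>N\<close>, whereas the drift makes that height grow linearly in \<open>N\<close>.\<close>
lemma (in prob_space) no_summable_crossing_with_drift:
  fixes V :: "nat \<Rightarrow> 'a \<Rightarrow> real"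
  assumes meas: "\<And>n. V n \<in> borel_measurable M"
    and V0: "\<And>\<omega>. \<omega> \<in> space M \<Longrightarrow> V 0 \<omega> = 0"
    and neg: "\<And>N t c. N \<le> t \<Longrightarrow>
       (\<integral>\<^sup>+ \<omega>. indicator {\<omega>\<in>space M. V N \<omega> > c} \<omega> * ennreal (V t \<omega> - V (Suc t) \<omega>) \<partial>M)
         \<le> ennreal C * emeasure M {\<omega>\<in>space M. V N \<omega> > c}"
    and drift: "\<And>t. (\<integral>\<^sup>+ \<omega>. ennreal (V t \<omega> - V (Suc t) \<omega>) \<partial>M)
       \<le> (\<integral>\<^sup>+ \<omega>. ennreal (V (Suc t) \<omega> - V t \<omega>) \<partial>M) + ennreal \<delta>"
    and fin: "(\<Sum>n. emeasure M {\<omega>\<in>space M. V n \<omega> > - (real n * \<kappa>)}) \<noteq> \<infinity>"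
    and C: "C > 0" and \<delta>: "0 \<le> \<delta>" "\<delta> < \<kappa>"
  shows False
proof -
  note [measurable] = meas
  define W where "W N \<omega> = V N \<omega> + real N * \<kappa>" for N \<omega>
  have [measurable]: "W N \<in> borel_measurable M" for N unfolding W_def by measurable
  define up where "up t \<omega> = ennreal (V (Suc t) \<omega> - V t \<omega>)" for t \<omega>
  define dn where "dn t \<omega> = ennreal (V t \<omega> - V (Suc t) \<omega>)" for t \<omega>
  have [measurable]: "up t \<in> borel_measurable M" "dn t \<in> borel_measurable M" for t
    unfolding up_def dn_def by measurable
  define T where "T = (\<Sum>n. emeasure M {\<omega>\<in>space M. V n \<omega> > - (real n * \<kappa>)})"
  have dnC: "(\<integral>\<^sup>+ \<omega>. dn t \<omega> \<partial>M) \<le> ennreal C" for t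
  proof -
    \<comment> \<open>Time 0 and level -1 make the event the whole space, because the process starts
      at 0.\<close>
    have "{\<omega>\<in>space M. V 0 \<omega> > -1} = space M" using V0 by auto
    then have "(\<integral>\<^sup>+ \<omega>. indicator (space M) \<omega> * ennreal (V t \<omega> - V (Suc t) \<omega>) \<partial>M) \<le> ennreal C * emeasure M (space M)"
      using neg[of 0 t "-1"] by simp
    moreover have "(\<integral>\<^sup>+ \<omega>. indicator (space M) \<omega> * ennreal (V t \<omega> - V (Suc t) \<omega>) \<partial>M) = (\<integral>\<^sup>+ \<omega>. dn t \<omega> \<partial>M)"
      unfolding dn_def by (intro nn_integral_cong) simp
    ultimately show ?thesis by (simp add: emeasure_space_1)
  qed
  \<comment> \<open>Telescoping with the drift: the mean positive height at time \<open>N\<close> is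
    at least \<open>N * (\<kappa> - \<delta>)\<close>. Upward steps may have infinite mean, so
    nothing is subtracted; only the downward steps, of mean at most \<open>C\<close> each, are
    cancelled.\<close>
  have claim1: "ennreal (real N * \<kappa>) \<le> (\<integral>\<^sup>+ \<omega>. ennreal (W N \<omega>) \<partial>M) + ennreal (real N * \<delta>)" for N
  proof -
    have pw: "(\<Sum>t<N. up t \<omega>) + ennreal (real N * \<kappa>) \<le> ennreal (W N \<omega>) + (\<Sum>t<N. dn t \<omega>)"
      if "\<omega> \<in> space M" for \<omega>
    proof -
      have "V N \<omega> = (\<Sum>t<N. V (Suc t) \<omega> - V t \<omega>)"
        using V0[OF that] sum_lessThan_telescope[of "\<lambda>t. V t \<omega>" N] by linarith
      also have "\<dots> = (\<Sum>t<N. max 0 (V (Suc t) \<omega> - V t \<omega>)) - (\<Sum>t<N. max 0 (V t \<omega> - V (Suc t) \<omega>))"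
        by (subst sum_subtractf[symmetric]) (intro sum.cong, auto simp: max_def)
      finally have eq: "(\<Sum>t<N. max 0 (V (Suc t) \<omega> - V t \<omega>)) + real N * \<kappa>
          = W N \<omega> + (\<Sum>t<N. max 0 (V t \<omega> - V (Suc t) \<omega>))" by (simp add: W_def)
      have "(\<Sum>t<N. up t \<omega>) = ennreal (\<Sum>t<N. max 0 (V (Suc t) \<omega> - V t \<omega>))"
        unfolding up_def by (rule sum_ennreal_max)
      moreover have "(\<Sum>t<N. dn t \<omega>) = ennreal (\<Sum>t<N. max 0 (V t \<omega> - V (Suc t) \<omega>))"
        unfolding dn_def by (rule sum_ennreal_max)
      moreover have "ennreal (\<Sum>t<N. max 0 (V (Suc t) \<omega> - V t \<omega>)) + ennreal (real N * \<kappa>)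
          \<le> ennreal (max 0 (W N \<omega>)) + ennreal (\<Sum>t<N. max 0 (V t \<omega> - V (Suc t) \<omega>))"
        using eq \<delta> by (subst (1 2) ennreal_plus[symmetric]) (auto intro!: sum_nonneg ennreal_leI)
      ultimately show ?thesis by (auto simp: max_def ennreal_neg split: if_splits)
    qed
    have "(\<integral>\<^sup>+ \<omega>. (\<Sum>t<N. up t \<omega>) + ennreal (real N * \<kappa>) \<partial>M)
        \<le> (\<integral>\<^sup>+ \<omega>. ennreal (W N \<omega>) + (\<Sum>t<N. dn t \<omega>) \<partial>M)"
      by (intro nn_integral_mono pw)
    then have *: "(\<Sum>t<N. \<integral>\<^sup>+ \<omega>. up t \<omega> \<partial>M) + ennreal (real N * \<kappa>)
        \<le> (\<integral>\<^sup>+ \<omega>. ennreal (W N \<omega>) \<partial>M) + (\<Sum>t<N. \<integral>\<^sup>+ \<omega>. dn t \<omega> \<partial>M)"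
      by (simp add: nn_integral_add nn_integral_sum emeasure_space_1)
    have "(\<Sum>t<N. \<integral>\<^sup>+ \<omega>. dn t \<omega> \<partial>M) \<le> (\<Sum>t<N. (\<integral>\<^sup>+ \<omega>. up t \<omega> \<partial>M) + ennreal \<delta>)"
      unfolding up_def dn_def by (intro sum_mono drift)
    also have "\<dots> = (\<Sum>t<N. \<integral>\<^sup>+ \<omega>. up t \<omega> \<partial>M) + ennreal (real N * \<delta>)"
      using \<delta> by (simp add: sum.distrib ennreal_mult' ennreal_of_nat_eq_real_of_nat)
    finally have "(\<Sum>t<N. \<integral>\<^sup>+ \<omega>. dn t \<omega> \<partial>M) + ennreal (real N * \<kappa>)
        \<le> (\<Sum>t<N. \<integral>\<^sup>+ \<omega>. up t \<omega> \<partial>M) + ennreal (real N * \<delta>) + ennreal (real N * \<kappa>)"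
      by (intro add_right_mono)
    also have "\<dots> = ((\<Sum>t<N. \<integral>\<^sup>+ \<omega>. up t \<omega> \<partial>M) + ennreal (real N * \<kappa>)) + ennreal (real N * \<delta>)"
      by (simp add: ac_simps)
    also have "\<dots> \<le> ((\<integral>\<^sup>+ \<omega>. ennreal (W N \<omega>) \<partial>M) + (\<Sum>t<N. \<integral>\<^sup>+ \<omega>. dn t \<omega> \<partial>M)) + ennreal (real N * \<delta>)"
      by (intro add_right_mono *)
    also have "\<dots> = (\<Sum>t<N. \<integral>\<^sup>+ \<omega>. dn t \<omega> \<partial>M) + ((\<integral>\<^sup>+ \<omega>. ennreal (W N \<omega>) \<partial>M) + ennreal (real N * \<delta>))"
      by (simp add: ac_simps)
    finally show ?thesis
    proof (rule ennreal_add_left_cancel_le[THEN iffD1, THEN disjE])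
      assume "(\<Sum>t<N. \<integral>\<^sup>+ \<omega>. dn t \<omega> \<partial>M) = \<infinity>"
      moreover have "(\<integral>\<^sup>+ \<omega>. dn t \<omega> \<partial>M) < \<infinity>" for t
        using dnC[of t] by (simp add: order.strict_trans1)
      ultimately show ?thesis by (simp add: ennreal_sum_less_top less_top[symmetric])
    qed
  qed
  \<comment> \<open>From a height above \<open>2 * C * m\<close> at time \<open>N\<close>, the line
    can be reached by time \<open>m + N\<close> only through a total descent beyond
    \<open>2 * C * m\<close> (the event \<open>G\<close>). On \<open>A\<close> the descent has
    integral at most \<open>m * C\<close> times the probability of \<open>A\<close>, so by Markov
    \<open>G\<close> takes up at most half of \<open>A\<close>. This is why the levels are spaced by
    \<open>2 * C\<close>.\<close>
  have claim2: "emeasure M {\<omega>\<in>space M. W N \<omega> > real m * (2 * C)}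
      \<le> 2 * emeasure M {\<omega>\<in>space M. V (m + N) \<omega> > - (real (m + N) * \<kappa>)}" for m N
  proof -
    define A where "A = {\<omega>\<in>space M. W N \<omega> > real m * (2 * C)}"
    define D where "D \<omega> = (\<Sum>t<m. dn (t + N) \<omega>)" for \<omega>
    define G where "G = {\<omega>\<in>space M. ennreal (real m * (2 * C)) < D \<omega> * indicator A \<omega>}"
    define B where "B = {\<omega>\<in>space M. V (m + N) \<omega> > - (real (m + N) * \<kappa>)}"
    have [measurable]: "A \<in> sets M" "D \<in> borel_measurable M" "B \<in> sets M" unfolding A_def D_def B_def by measurable
    have [measurable]: "G \<in> sets M" unfolding G_def by measurable
    have A': "A = {\<omega>\<in>space M. V N \<omega> > real m * (2 * C) - real N * \<kappa>}"
      by (auto simp: A_def W_def)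
    have "(\<integral>\<^sup>+ \<omega>. D \<omega> * indicator A \<omega> \<partial>M) = (\<Sum>t<m. \<integral>\<^sup>+ \<omega>. indicator A \<omega> * dn (t + N) \<omega> \<partial>M)"
      unfolding D_def by (subst nn_integral_sum[symmetric]) (auto simp: sum_distrib_left mult.commute)
    also have "\<dots> \<le> (\<Sum>t<m. ennreal C * emeasure M A)"
      unfolding A' dn_def by (intro sum_mono order_trans[OF _ neg]) auto
    finally have int: "(\<integral>\<^sup>+ \<omega>. D \<omega> * indicator A \<omega> \<partial>M) \<le> ennreal (real m * C) * emeasure M A"
      using C by (simp add: ennreal_mult' ennreal_of_nat_eq_real_of_nat mult_ac)
    have sub: "A - G \<subseteq> B"
    proof
      fix \<omega> assume w: "\<omega> \<in> A - G"
      then have wM: "\<omega> \<in> space M" by (auto simp: A_def)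
      have "D \<omega> \<le> ennreal (real m * (2 * C))" using w by (auto simp: G_def A_def not_less)
      moreover have "D \<omega> = ennreal (\<Sum>t<m. max 0 (V (t + N) \<omega> - V (Suc (t + N)) \<omega>))"
        unfolding dn_def D_def by (rule sum_ennreal_max)
      ultimately have "(\<Sum>t<m. max 0 (V (t + N) \<omega> - V (Suc (t + N)) \<omega>)) \<le> real m * (2 * C)"
        using C by (simp add: ennreal_le_iff)
      moreover have "V N \<omega> - V (m + N) \<omega> = (\<Sum>t<m. V (t + N) \<omega> - V (Suc (t + N)) \<omega>)"
        using sum_lessThan_telescope'[of "\<lambda>t. V (t + N) \<omega>" m] by simp
      moreover have "\<dots> \<le> (\<Sum>t<m. max 0 (V (t + N) \<omega> - V (Suc (t + N)) \<omega>))"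
        by (intro sum_mono) auto
      ultimately have "V N \<omega> - V (m + N) \<omega> \<le> real m * (2 * C)" by linarith
      moreover have "V N \<omega> + real N * \<kappa> > real m * (2 * C)" using w by (auto simp: A_def W_def)
      moreover have "real m * \<kappa> \<ge> 0" using \<delta> by simp
      ultimately show "\<omega> \<in> B" using wM unfolding B_def by (simp add: algebra_simps)
    qed
    have "emeasure M A \<le> 2 * emeasure M B"
    \<comment> \<open>Markov's inequality divides by \<open>m\<close>; for \<open>m = 0\<close>
      there is no descent at all.\<close>
    proof (cases "m = 0")
      case True
      then have "G = {}" by (auto simp: G_def D_def)
      with sub have "emeasure M A \<le> emeasure M B" by (intro emeasure_mono) auto
      also have "\<dots> \<le> 2 * emeasure M B" using mult_right_mono[of 1 2 "emeasure M B"] by simp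
      finally show ?thesis .
    next
      case False
      have "ennreal (real m * (2 * C)) * emeasure M G = (\<integral>\<^sup>+ \<omega>. ennreal (real m * (2 * C)) * indicator G \<omega> \<partial>M)"
        by (simp add: nn_integral_cmult_indicator)
      also have "\<dots> \<le> (\<integral>\<^sup>+ \<omega>. D \<omega> * indicator A \<omega> \<partial>M)"
        by (intro nn_integral_mono) (auto simp: G_def split: split_indicator)
      also note int
      finally have "ennreal (real m * (2 * C)) * emeasure M G \<le> ennreal (real m * C) * emeasure M A" .
      then have "(real m * (2 * C)) * prob G \<le> (real m * C) * prob A"
        using C by (simp add: emeasure_eq_measure ennreal_mult'[symmetric])
      then have g: "2 * prob G \<le> prob A" using C False by (simp add: field_simps)
      have "prob A \<le> prob (B \<union> G)" using sub by (intro finite_measure_mono) auto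
      also have "\<dots> \<le> prob B + prob G" by (intro measure_Un_le) auto
      finally have "prob A \<le> 2 * prob B" using g by linarith
      then show ?thesis by (simp add: emeasure_eq_measure ennreal_mult'[symmetric] flip: ennreal_numeral)
    qed
    then show ?thesis unfolding A_def B_def .
  qed
  \<comment> \<open>Level \<open>m\<close> of the height at time \<open>N\<close> is charged to time
    \<open>m + N\<close>. Different levels are charged to different times, so the tail probabilities
    sum to at most \<open>2 * T\<close>, uniformly in \<open>N\<close>.\<close>
  have claim3: "(\<integral>\<^sup>+ \<omega>. ennreal (W N \<omega>) \<partial>M) \<le> ennreal (4 * C) * T" for N
  proof -
    have "(\<integral>\<^sup>+ \<omega>. ennreal (W N \<omega>) \<partial>M)
        \<le> (\<integral>\<^sup>+ \<omega>. ennreal (2 * C) * (\<Sum>m. indicator {\<omega>\<in>space M. W N \<omega> > real m * (2 * C)} \<omega>) \<partial>M)"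
    proof (intro nn_integral_mono)
      fix \<omega> assume "\<omega> \<in> space M"
      then have "indicator {\<omega>\<in>space M. W N \<omega> > real m * (2 * C)} \<omega> = (indicator {y. y > real m * (2 * C)} (W N \<omega>) :: ennreal)" for m
        by (auto simp: indicator_def)
      then show "ennreal (W N \<omega>) \<le> ennreal (2 * C) * (\<Sum>m. indicator {\<omega>\<in>space M. W N \<omega> > real m * (2 * C)} \<omega>)"
        using ennreal_le_suminf_indicator[of "2 * C" "W N \<omega>"] C by simp
    qed
    also have "\<dots> = ennreal (2 * C) * (\<Sum>m. emeasure M {\<omega>\<in>space M. W N \<omega> > real m * (2 * C)})"
      by (simp add: nn_integral_cmult nn_integral_suminf)
    also have "(\<Sum>m. emeasure M {\<omega>\<in>space M. W N \<omega> > real m * (2 * C)})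
        \<le> (\<Sum>m. 2 * emeasure M {\<omega>\<in>space M. V (m + N) \<omega> > - (real (m + N) * \<kappa>)})"
      by (intro suminf_le claim2) auto
    also have "\<dots> = 2 * (\<Sum>m. emeasure M {\<omega>\<in>space M. V (m + N) \<omega> > - (real (m + N) * \<kappa>)})"
      by simp
    also have "(\<Sum>m. emeasure M {\<omega>\<in>space M. V (m + N) \<omega> > - (real (m + N) * \<kappa>)}) \<le> T"
      unfolding T_def
      using suminf_offset[of "\<lambda>n. emeasure M {\<omega>\<in>space M. V n \<omega> > - (real n * \<kappa>)}" N] by simp
    finally have "(\<integral>\<^sup>+ \<omega>. ennreal (W N \<omega>) \<partial>M) \<le> ennreal (2 * C) * (2 * T)"
      by (simp add: mult_left_mono)
    moreover have "ennreal (4 * C) = ennreal (2 * C) * ennreal 2"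
      using C by (subst ennreal_mult'[symmetric]) auto
    ultimately show ?thesis by (simp add: mult.assoc)
  qed
  obtain r where r: "T = ennreal r" "r \<ge> 0" using fin unfolding T_def[symmetric] by (cases T) auto
  obtain N :: nat where N: "real N * (\<kappa> - \<delta>) > 4 * C * r" using \<delta> reals_Archimedean3[of "\<kappa> - \<delta>"] by auto
  have "ennreal (real N * \<kappa>) \<le> ennreal (4 * C) * ennreal r + ennreal (real N * \<delta>)"
    using order_trans[OF claim1[of N] add_right_mono[OF claim3[of N]]] r by simp
  also have "\<dots> = ennreal (4 * C * r + real N * \<delta>)"
    using C r \<delta> by (simp add: ennreal_mult'[symmetric])
  finally have "real N * \<kappa> \<le> 4 * C * r + real N * \<delta>"
    using C r \<delta> by (subst (asm) ennreal_le_iff) auto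
  with N show False by (simp add: algebra_simps)
qed

section \<open>Log-likelihood ratios and Kullback--Leibler divergence\<close>

definition prob_density :: "'x measure \<Rightarrow> ('x \<Rightarrow> real) \<Rightarrow> bool" where
  "prob_density \<nu> g \<longleftrightarrow> g \<in> borel_measurable \<nu> \<and> (\<forall>x. g x \<ge> 0) \<and> (\<integral>\<^sup>+ x. ennreal (g x) \<partial>\<nu>) = 1"

lemma prob_space_density_fun:
  "prob_density \<nu> g \<Longrightarrow> prob_space (density \<nu> (\<lambda>x. ennreal (g x)))"
  unfolding prob_density_def by (intro prob_spaceI) (auto simp: emeasure_density cong: nn_integral_cong)

text \<open>Real-valued, unlike \<open>KL_integrand\<close>. With the weight \<open>f p x\<close>
  the two differ only where \<open>f s\<close> vanishes and \<open>f p\<close> does not; hence the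
  hypotheses of almost sure positivity below.\<close>

definition llr :: "('p \<Rightarrow> 'x \<Rightarrow> real) \<Rightarrow> 'p \<Rightarrow> 'p \<Rightarrow> 'x \<Rightarrow> real" where
  "llr f p s x = ln (f p x / f s x)"

context
  fixes \<nu> :: "'x measure" and f :: "'p \<Rightarrow> 'x \<Rightarrow> real" and p s :: 'p
  assumes p: "prob_density \<nu> (f p)" and s: "prob_density \<nu> (f s)"
begin

private lemma m: "f p \<in> borel_measurable \<nu>" "f s \<in> borel_measurable \<nu>"
  and nn: "f p x \<ge> 0" "f s x \<ge> 0"
  and i1: "(\<integral>\<^sup>+ x. ennreal (f p x) \<partial>\<nu>) = 1" "(\<integral>\<^sup>+ x. ennreal (f s x) \<partial>\<nu>) = 1"
  using p s by (auto simp: prob_density_def)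

private abbreviation "pos \<equiv> \<lambda>x. e2ennreal (KL_integrand f p s x)"
private abbreviation "neg \<equiv> \<lambda>x. e2ennreal (- KL_integrand f p s x)"

private lemma pos_eq: "pos x = (if f p x = 0 then 0 else if f s x = 0 then \<infinity> else ennreal (f p x * llr f p s x))"
  by (auto simp: KL_integrand_def llr_def e2ennreal_ereal e2ennreal_infty)

private lemma neg_eq: "neg x = (if f p x = 0 then 0 else if f s x = 0 then 0 else ennreal (- (f p x * llr f p s x)))"
  by (auto simp: KL_integrand_def llr_def e2ennreal_ereal e2ennreal_neg)

private lemma mpn: "pos \<in> borel_measurable \<nu>" "neg \<in> borel_measurable \<nu>"
  using m unfolding pos_eq neg_eq llr_def by measurable

lemma llr_measurable: "llr f p s \<in> borel_measurable \<nu>"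
  using m unfolding llr_def by measurable

text \<open>\<open>ln y \<le> y - 1\<close> at \<open>y = f s x / f p x\<close>. It yields both the
  bound on the negative part and Gibbs' inequality.\<close>

private lemma tangent:
  assumes "f p x > 0" "f s x > 0"
  shows "f p x * llr f p s x \<ge> f p x - f s x"
proof -
  have "ln (f s x / f p x) \<le> f s x / f p x - 1" using assms by (intro ln_le_minus_one) simp
  then have "f p x * ln (f s x / f p x) \<le> f p x * (f s x / f p x - 1)"
    using assms by (intro mult_left_mono) auto
  moreover have "f p x * (f s x / f p x - 1) = f s x - f p x" using assms by (simp add: field_simps)
  moreover have "llr f p s x = - ln (f s x / f p x)" using assms by (simp add: llr_def ln_div)
  ultimately show ?thesis by simp
qed

text \<open>By \<open>tangent\<close> the negative part is at most \<open>f s\<close>, which has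
  mass 1. The bound does not depend on \<open>s\<close>, so it applies to whatever estimate the data
  produce.\<close>

lemma KL_neg_part_le_1: "(\<integral>\<^sup>+ x. neg x \<partial>\<nu>) \<le> 1"
proof -
  note [measurable] = m mpn
  have "neg x \<le> ennreal (f s x)" for x
    using tangent[of x] nn[of x] by (auto simp: neg_eq intro!: ennreal_leI)
  then have "(\<integral>\<^sup>+ x. neg x \<partial>\<nu>) \<le> (\<integral>\<^sup>+ x. ennreal (f s x) \<partial>\<nu>)" by (intro nn_integral_mono)
  then show ?thesis by (simp add: i1)
qed

text \<open>Gibbs' inequality, written with sums because the positive part may be infinite; the unit
  masses of \<open>f p\<close> and \<open>f s\<close> cancel.\<close>

lemma KL_neg_part_le_pos_part: "(\<integral>\<^sup>+ x. neg x \<partial>\<nu>) \<le> (\<integral>\<^sup>+ x. pos x \<partial>\<nu>)"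
proof -
  note [measurable] = m mpn
  have "neg x + ennreal (f p x) \<le> pos x + ennreal (f s x)" for x
  proof (cases "f p x = 0 \<or> f s x = 0")
    case False
    then have "f p x * llr f p s x \<ge> f p x - f s x" using nn[of x] by (intro tangent) auto
    then show ?thesis using False nn[of x]
      by (cases "f p x * llr f p s x \<ge> 0")
         (auto simp: pos_eq neg_eq ennreal_neg ennreal_plus[symmetric] simp del: ennreal_plus intro!: ennreal_leI)
  qed (auto simp: pos_eq neg_eq)
  then have "(\<integral>\<^sup>+ x. neg x + ennreal (f p x) \<partial>\<nu>) \<le> (\<integral>\<^sup>+ x. pos x + ennreal (f s x) \<partial>\<nu>)"
    by (intro nn_integral_mono)
  then show ?thesis by (simp add: nn_integral_add i1)
qed

text \<open>The bounded negative part rules out \<open>\<infinity> - \<infinity>\<close> in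
  \<open>KL\<close>.\<close>

private lemma KL_cases:
  obtains r where "(\<integral>\<^sup>+ x. neg x \<partial>\<nu>) = ennreal r" "0 \<le> r" "KL \<nu> f p s = enn2ereal (\<integral>\<^sup>+ x. pos x \<partial>\<nu>) - ereal r"
proof -
  have "(\<integral>\<^sup>+ x. neg x \<partial>\<nu>) \<noteq> \<infinity>" using KL_neg_part_le_1 by (auto simp: top_unique)
  then obtain r where "(\<integral>\<^sup>+ x. neg x \<partial>\<nu>) = ennreal r" "0 \<le> r" by (cases "\<integral>\<^sup>+ x. neg x \<partial>\<nu>") auto
  then show ?thesis using that by (simp add: KL_def)
qed

lemma KL_nonneg: "KL \<nu> f p s \<ge> 0"
proof -
  obtain r where r: "(\<integral>\<^sup>+ x. neg x \<partial>\<nu>) = ennreal r" "0 \<le> r" "KL \<nu> f p s = enn2ereal (\<integral>\<^sup>+ x. pos x \<partial>\<nu>) - ereal r"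
    by (rule KL_cases)
  show ?thesis
    using r KL_neg_part_le_pos_part by (cases "\<integral>\<^sup>+ x. pos x \<partial>\<nu>") (auto simp: enn2ereal_ennreal)
qed

text \<open>The integrand is infinite where \<open>f p\<close> is positive and \<open>f s\<close>
  vanishes, so a finite divergence makes that set null.\<close>

lemma AE_pos_of_KL_finite:
  assumes "KL \<nu> f p s < \<infinity>"
  shows "AE x in density \<nu> (\<lambda>x. ennreal (f p x)). f s x > 0"
proof -
  note [measurable] = m mpn
  obtain r where r: "KL \<nu> f p s = enn2ereal (\<integral>\<^sup>+ x. pos x \<partial>\<nu>) - ereal r"
    by (rule KL_cases)
  have "(\<integral>\<^sup>+ x. pos x \<partial>\<nu>) \<noteq> \<infinity>" using assms unfolding r by auto
  then have "AE x in \<nu>. pos x \<noteq> \<infinity>" by (intro nn_integral_PInf_AE) auto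
  then have "AE x in \<nu>. 0 < ennreal (f p x) \<longrightarrow> f s x > 0"
    by (rule AE_mp) (use nn in \<open>auto simp: pos_eq less_le split: if_splits intro!: AE_I2\<close>)
  then show ?thesis by (simp add: AE_density)
qed

private lemma llr_integrals:
  assumes "AE x in density \<nu> (\<lambda>x. ennreal (f p x)). f s x > 0"
  shows "(\<integral>\<^sup>+ x. ennreal (llr f p s x) \<partial>density \<nu> (\<lambda>x. ennreal (f p x))) = (\<integral>\<^sup>+ x. pos x \<partial>\<nu>)"
    and "(\<integral>\<^sup>+ x. ennreal (- llr f p s x) \<partial>density \<nu> (\<lambda>x. ennreal (f p x))) = (\<integral>\<^sup>+ x. neg x \<partial>\<nu>)"
proof -
  note [measurable] = m mpn llr_measurable
  have ae: "AE x in \<nu>. f p x > 0 \<longrightarrow> f s x > 0" using assms by (simp add: AE_density)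
  show "(\<integral>\<^sup>+ x. ennreal (llr f p s x) \<partial>density \<nu> (\<lambda>x. ennreal (f p x))) = (\<integral>\<^sup>+ x. pos x \<partial>\<nu>)"
    by (subst nn_integral_density, simp, simp, rule nn_integral_cong_AE, rule AE_mp[OF ae], rule AE_I2)
       (use nn in \<open>auto simp: pos_eq less_le ennreal_mult'\<close>)
  show "(\<integral>\<^sup>+ x. ennreal (- llr f p s x) \<partial>density \<nu> (\<lambda>x. ennreal (f p x))) = (\<integral>\<^sup>+ x. neg x \<partial>\<nu>)"
    by (subst nn_integral_density, simp, simp, rule nn_integral_cong_AE, rule AE_mp[OF ae], rule AE_I2)
       (use nn in \<open>auto simp: neg_eq less_le ennreal_mult'[symmetric]\<close>)
qed

lemma llr_neg_integral_le_1:
  assumes "AE x in density \<nu> (\<lambda>x. ennreal (f p x)). f s x > 0"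
  shows "(\<integral>\<^sup>+ x. ennreal (- llr f p s x) \<partial>density \<nu> (\<lambda>x. ennreal (f p x))) \<le> 1"
  using llr_integrals[OF assms] KL_neg_part_le_1 by simp

text \<open>A lower bound on the mean log-likelihood ratio, put additively because its positive part
  may have infinite integral.\<close>

lemma llr_integral_lower:
  assumes "AE x in density \<nu> (\<lambda>x. ennreal (f p x)). f s x > 0" "ereal J \<le> KL \<nu> f p s" "0 \<le> J"
  shows "ennreal J + (\<integral>\<^sup>+ x. ennreal (- llr f p s x) \<partial>density \<nu> (\<lambda>x. ennreal (f p x)))
     \<le> (\<integral>\<^sup>+ x. ennreal (llr f p s x) \<partial>density \<nu> (\<lambda>x. ennreal (f p x)))"
proof -
  obtain r where r: "(\<integral>\<^sup>+ x. neg x \<partial>\<nu>) = ennreal r" "0 \<le> r" "KL \<nu> f p s = enn2ereal (\<integral>\<^sup>+ x. pos x \<partial>\<nu>) - ereal r"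
    by (rule KL_cases)
  have "ennreal J + (\<integral>\<^sup>+ x. neg x \<partial>\<nu>) \<le> (\<integral>\<^sup>+ x. pos x \<partial>\<nu>)"
    using r assms by (cases "\<integral>\<^sup>+ x. pos x \<partial>\<nu>") (auto simp: enn2ereal_ennreal ennreal_plus[symmetric] simp del: ennreal_plus intro!: ennreal_leI)
  then show ?thesis using llr_integrals[OF assms(1)] by simp
qed

lemma llr_integral_upper:
  assumes "KL \<nu> f p s \<le> ereal u" "0 \<le> u"
  shows "(\<integral>\<^sup>+ x. ennreal (llr f p s x) \<partial>density \<nu> (\<lambda>x. ennreal (f p x)))
     \<le> ennreal u + (\<integral>\<^sup>+ x. ennreal (- llr f p s x) \<partial>density \<nu> (\<lambda>x. ennreal (f p x)))"
proof -
  obtain r where r: "(\<integral>\<^sup>+ x. neg x \<partial>\<nu>) = ennreal r" "0 \<le> r" "KL \<nu> f p s = enn2ereal (\<integral>\<^sup>+ x. pos x \<partial>\<nu>) - ereal r"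
    by (rule KL_cases)
  have "(\<integral>\<^sup>+ x. pos x \<partial>\<nu>) \<le> ennreal u + (\<integral>\<^sup>+ x. neg x \<partial>\<nu>)"
    using r assms by (cases "\<integral>\<^sup>+ x. pos x \<partial>\<nu>") (auto simp: enn2ereal_ennreal ennreal_plus[symmetric] simp del: ennreal_plus intro!: ennreal_leI)
  moreover have "KL \<nu> f p s < \<infinity>" using assms by (auto simp: le_less_trans)
  ultimately show ?thesis using llr_integrals[OF AE_pos_of_KL_finite] by simp
qed

end

section \<open>The plug-in likelihood\<close>

text \<open>\<open>a k\<close> and \<open>b k\<close> will be the log-likelihood ratios of the truth
  against the estimate and against the competitor, so \<open>b - a\<close> summed over the streams
  is a downward step of the walk. The constant: all \<open>a k\<close> and \<open>b k\<close> have
  negative parts of mean at most 1, and the positive parts of the \<open>b k\<close> exceed their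
  negative parts by at most \<open>J + \<delta>\<close> in total. The drift: the estimates lose at
  least \<open>J\<close>, the competitor at most \<open>J + \<delta>\<close>.\<close>

lemma nn_integral_sum_difference:
  fixes a b :: "nat \<Rightarrow> 'a \<Rightarrow> real"
  assumes [measurable]: "\<And>k. k < K \<Longrightarrow> a k \<in> borel_measurable M" "\<And>k. k < K \<Longrightarrow> b k \<in> borel_measurable M"
    and A1: "\<And>k. k < K \<Longrightarrow> (\<integral>\<^sup>+ x. ennreal (- a k x) \<partial>M) \<le> 1"
    and B1: "\<And>k. k < K \<Longrightarrow> (\<integral>\<^sup>+ x. ennreal (- b k x) \<partial>M) \<le> 1"
    and A2: "\<And>k. k < K \<Longrightarrow> ennreal J + (\<integral>\<^sup>+ x. ennreal (- a k x) \<partial>M) \<le> (\<integral>\<^sup>+ x. ennreal (a k x) \<partial>M)"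
    and B2: "(\<Sum>k<K. \<integral>\<^sup>+ x. ennreal (b k x) \<partial>M) \<le> ennreal (J + \<delta>) + (\<Sum>k<K. \<integral>\<^sup>+ x. ennreal (- b k x) \<partial>M)"
    and nn: "0 \<le> J" "0 \<le> \<delta>" and K: "K \<ge> 1"
  shows "(\<integral>\<^sup>+ x. ennreal (\<Sum>k<K. b k x - a k x) \<partial>M) \<le> ennreal (2 * real K + J + \<delta>)"
    and "(\<integral>\<^sup>+ x. ennreal (\<Sum>k<K. b k x - a k x) \<partial>M) \<le> (\<integral>\<^sup>+ x. ennreal (\<Sum>k<K. a k x - b k x) \<partial>M) + ennreal \<delta>"
proof -
  define Ap where "Ap = (\<Sum>k<K. \<integral>\<^sup>+ x. ennreal (a k x) \<partial>M)"
  define An where "An = (\<Sum>k<K. \<integral>\<^sup>+ x. ennreal (- a k x) \<partial>M)"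
  define Bp where "Bp = (\<Sum>k<K. \<integral>\<^sup>+ x. ennreal (b k x) \<partial>M)"
  define Bn where "Bn = (\<Sum>k<K. \<integral>\<^sup>+ x. ennreal (- b k x) \<partial>M)"
  define Y where "Y = (\<integral>\<^sup>+ x. ennreal (\<Sum>k<K. b k x - a k x) \<partial>M)"
  define X where "X = (\<integral>\<^sup>+ x. ennreal (\<Sum>k<K. a k x - b k x) \<partial>M)"
  have An: "An \<le> ennreal (real K)"
    using sum_mono[of "{..<K}" "\<lambda>k. \<integral>\<^sup>+ x. ennreal (- a k x) \<partial>M" "\<lambda>_. 1"] A1
    by (simp add: An_def ennreal_of_nat_eq_real_of_nat)
  have Bn: "Bn \<le> ennreal (real K)"
    using sum_mono[of "{..<K}" "\<lambda>k. \<integral>\<^sup>+ x. ennreal (- b k x) \<partial>M" "\<lambda>_. 1"] B1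
    by (simp add: Bn_def ennreal_of_nat_eq_real_of_nat)
  have Bp: "Bp \<le> ennreal (J + \<delta>) + Bn" using B2 by (simp add: Bp_def Bn_def)
  have Ap: "ennreal J + An \<le> Ap"
  proof -
    \<comment> \<open>The loss \<open>J\<close> of a single stream is enough, because
      \<open>B2\<close> bounds the competitor's loss over all streams together.\<close>
    have "ennreal J \<le> (\<Sum>k<K. ennreal J)"
      using K nn member_le_sum[of 0 "{..<K}" "\<lambda>_. ennreal J"] by simp
    then have "ennreal J + An \<le> (\<Sum>k<K. ennreal J + (\<integral>\<^sup>+ x. ennreal (- a k x) \<partial>M))"
      unfolding An_def sum.distrib by (intro add_right_mono)
    also have "\<dots> \<le> Ap" unfolding Ap_def by (intro sum_mono A2) auto
    finally show ?thesis .
  qed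
  have pw1: "ennreal (\<Sum>k<K. b k x - a k x) \<le> (\<Sum>k<K. ennreal (- a k x)) + (\<Sum>k<K. ennreal (b k x))" for x
    unfolding sum_ennreal_max
    by (subst ennreal_plus[symmetric]) (auto simp: sum.distrib[symmetric] intro!: sum_nonneg ennreal_leI sum_mono)
  \<comment> \<open>Two splittings of one real sum into positive and negative parts, arranged
    without subtraction so that infinite integrals are harmless.\<close>
  have pw2: "ennreal (\<Sum>k<K. b k x - a k x) + ((\<Sum>k<K. ennreal (a k x)) + (\<Sum>k<K. ennreal (- b k x)))
     = ennreal (\<Sum>k<K. a k x - b k x) + ((\<Sum>k<K. ennreal (- a k x)) + (\<Sum>k<K. ennreal (b k x)))" for x
  proof -
    define d where "d = (\<Sum>k<K. a k x - b k x)"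
    have d': "(\<Sum>k<K. b k x - a k x) = - d" unfolding d_def by (simp add: sum_negf[symmetric])
    have max0: "ennreal y = ennreal (max 0 y)" for y by (simp add: max_def ennreal_neg)
    have "max 0 (- d) + ((\<Sum>k<K. max 0 (a k x)) + (\<Sum>k<K. max 0 (- b k x)))
       = max 0 d + ((\<Sum>k<K. max 0 (- a k x)) + (\<Sum>k<K. max 0 (b k x)))"
    proof -
      have "d = (\<Sum>k<K. (max 0 (a k x) + max 0 (- b k x)) - (max 0 (- a k x) + max 0 (b k x)))"
        unfolding d_def by (intro sum.cong) (auto simp: max_def)
      then show ?thesis by (simp add: sum_subtractf sum.distrib max_def)
    qed
    moreover have "ennreal u + (ennreal v + ennreal w) = ennreal (u + (v + w))"
      if "0 \<le> u" "0 \<le> v" "0 \<le> w" for u v w :: real using that by simp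
    ultimately have "ennreal (max 0 (- d)) + (ennreal (\<Sum>k<K. max 0 (a k x)) + ennreal (\<Sum>k<K. max 0 (- b k x)))
       = ennreal (max 0 d) + (ennreal (\<Sum>k<K. max 0 (- a k x)) + ennreal (\<Sum>k<K. max 0 (b k x)))"
      by (simp only: sum_nonneg max.cobounded1)
    then show ?thesis unfolding d' d_def[symmetric] sum_ennreal_max max0[symmetric] .
  qed
  have [measurable]: "(\<lambda>x. \<Sum>k<K. ennreal (c k x)) \<in> borel_measurable M"
    and int: "(\<integral>\<^sup>+ x. (\<Sum>k<K. ennreal (c k x)) \<partial>M) = (\<Sum>k<K. \<integral>\<^sup>+ x. ennreal (c k x) \<partial>M)"
    if "\<And>k. k < K \<Longrightarrow> c k \<in> borel_measurable M" for c
    using that by (auto intro!: borel_measurable_sum nn_integral_sum)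
  have [measurable]: "(\<lambda>x. ennreal (\<Sum>k<K. b k x - a k x)) \<in> borel_measurable M"
      "(\<lambda>x. ennreal (\<Sum>k<K. a k x - b k x)) \<in> borel_measurable M"
    by (auto intro!: measurable_compose[OF _ measurable_ennreal] borel_measurable_sum borel_measurable_diff)
  have "Y \<le> (\<integral>\<^sup>+ x. (\<Sum>k<K. ennreal (- a k x)) + (\<Sum>k<K. ennreal (b k x)) \<partial>M)"
    unfolding Y_def by (intro nn_integral_mono pw1)
  also have "\<dots> = An + Bp" by (simp add: nn_integral_add int An_def Bp_def)
  also have "\<dots> \<le> ennreal (real K) + (ennreal (J + \<delta>) + ennreal (real K))"
    by (intro add_mono An order_trans[OF Bp] Bn order_refl)
  also have "\<dots> = ennreal (2 * real K + J + \<delta>)"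
    using nn by (simp add: ennreal_plus[symmetric] del: ennreal_plus)
  finally show "(\<integral>\<^sup>+ x. ennreal (\<Sum>k<K. b k x - a k x) \<partial>M) \<le> ennreal (2 * real K + J + \<delta>)" by (simp add: Y_def)
  have "Y + (Ap + Bn) = (\<integral>\<^sup>+ x. ennreal (\<Sum>k<K. b k x - a k x) + ((\<Sum>k<K. ennreal (a k x)) + (\<Sum>k<K. ennreal (- b k x))) \<partial>M)"
    by (simp add: nn_integral_add int Ap_def Bn_def Y_def)
  also have "\<dots> = X + (An + Bp)"
    unfolding pw2 by (simp add: nn_integral_add int An_def Bp_def X_def)
  finally have eq: "Y + (Ap + Bn) = X + (An + Bp)" .
  have "(ennreal J + An + Bn) + Y \<le> Y + (Ap + Bn)"
    using add_mono[OF Ap order_refl[of "Bn + Y"]] by (simp add: ac_simps)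
  also have "\<dots> \<le> X + (An + (ennreal (J + \<delta>) + Bn))"
    unfolding eq by (intro add_mono order_refl Bp)
  also have "\<dots> = (ennreal J + An + Bn) + (X + ennreal \<delta>)"
    using nn by (simp add: ac_simps)
  finally have "ennreal J + An + Bn = \<infinity> \<or> Y \<le> X + ennreal \<delta>" by (simp only: ennreal_add_left_cancel_le infinity_ennreal_def)
  moreover have "ennreal J + An + Bn \<noteq> \<infinity>" using An Bn by (auto simp: top_unique)
  ultimately show "(\<integral>\<^sup>+ x. ennreal (\<Sum>k<K. b k x - a k x) \<partial>M) \<le> (\<integral>\<^sup>+ x. ennreal (\<Sum>k<K. a k x - b k x) \<partial>M) + ennreal \<delta>"
    by (simp add: X_def Y_def)
qed

lemma AE_PiM_component_iff:
  assumes "\<And>i. i \<in> I \<Longrightarrow> prob_space (M i)" "i \<in> I" "{x \<in> space (M i). P x} \<in> sets (M i)"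
  shows "(AE \<omega> in PiM I M. P (\<omega> i)) \<longleftrightarrow> (AE x in M i. P x)"
proof -
  have "(AE x in distr (PiM I M) (M i) (\<lambda>\<omega>. \<omega> i). P x) \<longleftrightarrow> (AE \<omega> in PiM I M. P (\<omega> i))"
    using assms by (intro AE_distr_iff) auto
  moreover have "distr (PiM I M) (M i) (\<lambda>\<omega>. \<omega> i) = M i"
    using assms by (intro distr_PiM_component) auto
  ultimately show ?thesis by (simp only:)
qed

lemma nn_integral_PiM_component:
  assumes "\<And>i. i \<in> I \<Longrightarrow> prob_space (M i)" "i \<in> I" "g \<in> borel_measurable (M i)"
  shows "(\<integral>\<^sup>+ \<omega>. g (\<omega> i) \<partial>PiM I M) = (\<integral>\<^sup>+ x. g x \<partial>M i)"
proof -
  have "(\<integral>\<^sup>+ x. g x \<partial>distr (PiM I M) (M i) (\<lambda>\<omega>. \<omega> i)) = (\<integral>\<^sup>+ \<omega>. g (\<omega> i) \<partial>PiM I M)"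
    using assms by (intro nn_integral_distr) auto
  moreover have "distr (PiM I M) (M i) (\<lambda>\<omega>. \<omega> i) = M i"
    using assms by (intro distr_PiM_component) auto
  ultimately show ?thesis by (simp only:)
qed

section \<open>Laws and one-step factorisation of the plug-in likelihood\<close>

locale plug_in_setup =
  fixes K :: nat and \<nu> :: "'x measure" and f :: "'p \<Rightarrow> 'x \<Rightarrow> real" and \<Theta> :: "'p set"
    and thhat :: "nat \<Rightarrow> nat \<Rightarrow> (nat \<Rightarrow> 'x) \<Rightarrow> 'p"
  assumes K: "K \<ge> 1"
    and dens: "\<And>\<theta>. \<theta> \<in> \<Theta> \<Longrightarrow> prob_density \<nu> (f \<theta>)"
    and thhat_in: "\<And>k n x. k < K \<Longrightarrow> thhat k n x \<in> \<Theta>"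
    and thhat_cong: "\<And>k n x y. k < K \<Longrightarrow> (\<And>t. t \<in> {1..n} \<Longrightarrow> x t = y t) \<Longrightarrow> thhat k n x = thhat k n y"
    and Lhat_meas: "\<And>n. Lhat K f thhat n \<in> borel_measurable (PiM ({..<K} \<times> UNIV) (\<lambda>_. \<nu>))"
begin

abbreviation "Idx \<equiv> {..<K} \<times> (UNIV :: nat set)"
abbreviation "P \<equiv> Pth K \<nu> f"

definition law :: "'p \<Rightarrow> 'x measure" where "law \<theta> = density \<nu> (\<lambda>x. ennreal (f \<theta> x))"

definition lhat :: "nat \<Rightarrow> (nat \<times> nat \<Rightarrow> 'x) \<Rightarrow> real" where
  "lhat n \<omega> = (\<Prod>t\<in>{1..n}. \<Prod>k<K. f (thhat k (t - 1) (stream \<omega> k)) (\<omega> (k, t)))"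

lemma Lhat_eq: "Lhat K f thhat n \<omega> = ennreal (lhat n \<omega>)"
  by (simp add: Lhat_def lhat_def)

lemma f_nonneg: "\<theta> \<in> \<Theta> \<Longrightarrow> f \<theta> x \<ge> 0"
  using dens unfolding prob_density_def by blast

lemma f_meas: "\<theta> \<in> \<Theta> \<Longrightarrow> f \<theta> \<in> borel_measurable \<nu>"
  using dens unfolding prob_density_def by blast

lemma lhat_nonneg: "lhat n \<omega> \<ge> 0"
  unfolding lhat_def by (intro prod_nonneg) (auto intro!: f_nonneg thhat_in)

lemma lhat_enn2real: "lhat n = (\<lambda>\<omega>. enn2real (Lhat K f thhat n \<omega>))"
  by (simp add: Lhat_eq lhat_nonneg fun_eq_iff)

lemma Lvec_nonneg: "(\<And>k. k < K \<Longrightarrow> th k \<in> \<Theta>) \<Longrightarrow> Lvec K f n th \<omega> \<ge> 0"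
  unfolding Lvec_def Lik_def by (intro prod_nonneg) (auto intro!: f_nonneg)

lemma lhat_Suc:
  "lhat (Suc n) \<omega> = lhat n \<omega> * (\<Prod>k<K. f (thhat k n (stream \<omega> k)) (\<omega> (k, Suc n)))"
  by (simp add: lhat_def)

lemma Lvec_Suc: "Lvec K f (Suc n) th \<omega> = Lvec K f n th \<omega> * (\<Prod>k<K. f (th k) (\<omega> (k, Suc n)))"
  by (simp add: Lvec_def Lik_def prod.distrib)

lemma thhat_stream_cong:
  assumes "k < K" "\<And>k t. t \<le> n \<Longrightarrow> \<omega> (k, t) = \<omega>' (k, t)"
  shows "thhat k n (stream \<omega> k) = thhat k n (stream \<omega>' k)"
  using assms by (intro thhat_cong) (auto simp: stream_def)

lemma lhat_cong:
  assumes "\<And>k t. t \<le> n \<Longrightarrow> \<omega> (k, t) = \<omega>' (k, t)"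
  shows "lhat n \<omega> = lhat n \<omega>'"
proof -
  have "thhat k (t - 1) (stream \<omega> k) = thhat k (t - 1) (stream \<omega>' k)" if "k < K" "t \<in> {1..n}" for k t
    using that assms by (intro thhat_stream_cong) auto
  then show ?thesis using assms by (simp add: lhat_def)
qed

lemma Lvec_cong:
  assumes "\<And>k t. t \<le> n \<Longrightarrow> \<omega> (k, t) = \<omega>' (k, t)"
  shows "Lvec K f n th \<omega> = Lvec K f n th \<omega>'"
  using assms by (simp add: Lvec_def Lik_def)

lemma law_prob: "\<theta> \<in> \<Theta> \<Longrightarrow> prob_space (law \<theta>)"
  unfolding law_def by (intro prob_space_density_fun dens)

lemma sets_law[simp, measurable_cong]: "sets (law \<theta>) = sets \<nu>" by (simp add: law_def)

lemma space_law[simp]: "space (law \<theta>) = space \<nu>" by (simp add: law_def)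

lemma P_eq: "P th = PiM Idx (\<lambda>i. law (th (fst i)))"
  by (simp add: Pth_def law_def case_prod_beta')

lemma sets_P[measurable_cong]: "sets (P th) = sets (PiM Idx (\<lambda>_. \<nu>))"
  unfolding P_eq by (intro sets_PiM_cong) auto

lemma space_P: "space (P th) = space (PiM Idx (\<lambda>_. \<nu>))"
  using sets_P by (rule sets_eq_imp_space_eq)

lemma P_prob: "(\<And>k. k < K \<Longrightarrow> th k \<in> \<Theta>) \<Longrightarrow> prob_space (P th)"
  unfolding P_eq by (intro prob_space_PiM law_prob) auto

lemma lhat_meas[measurable]: "lhat n \<in> borel_measurable (PiM Idx (\<lambda>_. \<nu>))"
  unfolding lhat_enn2real using Lhat_meas by measurable

lemma Lvec_meas: 
  assumes "\<And>k. k < K \<Longrightarrow> th k \<in> \<Theta>"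
  shows "Lvec K f n th \<in> borel_measurable (PiM Idx (\<lambda>_. \<nu>))"
proof -
  have "(\<lambda>\<omega>. f (th k) (\<omega> (k, t))) \<in> borel_measurable (PiM Idx (\<lambda>_. \<nu>))" if "k < K" for k t
    using that f_meas[OF assms[OF that]] by (intro measurable_compose[OF measurable_component_singleton]) auto
  then show ?thesis unfolding Lvec_def[abs_def] Lik_def[abs_def] by (intro borel_measurable_prod) auto
qed

lemma AE_P_component:
  assumes th: "\<And>k. k < K \<Longrightarrow> th k \<in> \<Theta>" and k: "k < K" and \<theta>: "\<theta> \<in> \<Theta>"
  shows "(AE \<omega> in P th. f \<theta> (\<omega> (k, t)) > 0) \<longleftrightarrow> (AE x in law (th k). f \<theta> x > 0)"
proof -
  have "(AE \<omega> in PiM Idx (\<lambda>i. law (th (fst i))). f \<theta> (\<omega> (k, t)) > 0)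
      \<longleftrightarrow> (AE x in law (th (fst (k, t))). f \<theta> x > 0)"
    using f_meas[OF \<theta>] th k law_prob by (intro AE_PiM_component_iff) auto
  then show ?thesis unfolding P_eq fst_conv .
qed

lemma AE_Lvec_pos:
  assumes th: "\<And>k. k < K \<Longrightarrow> th k \<in> \<Theta>" and e: "\<And>k. k < K \<Longrightarrow> e k \<in> \<Theta>"
    and pos: "\<And>k. k < K \<Longrightarrow> AE x in law (th k). f (e k) x > 0"
  shows "AE \<omega> in P th. Lvec K f n e \<omega> > 0"
proof -
  have 1: "AE \<omega> in P th. f (e k) (\<omega> (k, t)) > 0" if k: "k < K" for k t
  proof -
    note * = AE_P_component[where th=th and k=k and \<theta>="e k" and t=t]
    have "(AE \<omega> in P th. f (e k) (\<omega> (k, t)) > 0) \<longleftrightarrow> (AE x in law (th k). f (e k) x > 0)"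
      apply (rule *)
      apply (erule th)
      apply (rule k)
      apply (rule e)
      apply (rule k)
      done
    then show ?thesis using pos[OF k] by (rule iffD2)
  qed
  have 2: "AE \<omega> in P th. \<forall>t\<in>{1..n}. f (e k) (\<omega> (k, t)) > 0" if "k < K" for k
    apply (rule AE_finite_allI) apply simp apply (rule 1) apply (rule that) done
  have 3: "AE \<omega> in P th. \<forall>k\<in>{..<K}. \<forall>t\<in>{1..n}. f (e k) (\<omega> (k, t)) > 0"
    apply (rule AE_finite_allI) apply simp apply (rule 2) apply simp done
  show ?thesis
    by (rule AE_mp[OF 3]) (auto simp: Lvec_def Lik_def intro!: AE_I2 prod_pos)
qed

section \<open>Conditioning on the observations up to time n\<close>

definition future :: "nat \<Rightarrow> (nat \<times> nat) set" where "future n = {i. n < snd i}"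

abbreviation "renew n \<equiv> resample (future n)"

lemma renew_le: "t \<le> n \<Longrightarrow> renew n \<omega> \<omega>' (k, t) = \<omega> (k, t)"
  by (simp add: resample_def future_def)

lemma renew_gt: "n < t \<Longrightarrow> renew n \<omega> \<omega>' (k, t) = \<omega>' (k, t)"
  by (simp add: resample_def future_def)

lemma renew_past:
  "m \<le> n \<Longrightarrow> lhat m (renew n \<omega> \<omega>') = lhat m \<omega>"
  "m \<le> n \<Longrightarrow> Lvec K f m th (renew n \<omega> \<omega>') = Lvec K f m th \<omega>"
  "k < K \<Longrightarrow> thhat k n (stream (renew n \<omega> \<omega>') k) = thhat k n (stream \<omega> k)"
  by (auto intro!: lhat_cong Lvec_cong thhat_stream_cong simp: renew_le)

lemma renew_space: "\<omega> \<in> space (P th) \<Longrightarrow> \<omega>' \<in> space (P th') \<Longrightarrow> renew n \<omega> \<omega>' \<in> space (P th'')"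
  by (auto simp: space_P space_PiM PiE_iff resample_def extensional_def)

lemma lhat_renew_Suc:
  "lhat (Suc n) (renew n \<omega> \<omega>') = lhat n \<omega> * (\<Prod>k<K. f (thhat k n (stream \<omega> k)) (\<omega>' (k, Suc n)))"
  by (simp add: lhat_Suc renew_past renew_gt)

lemma Lvec_renew_Suc:
  "Lvec K f (Suc n) th (renew n \<omega> \<omega>') = Lvec K f n th \<omega> * (\<Prod>k<K. f (th k) (\<omega>' (k, Suc n)))"
  by (simp add: Lvec_Suc renew_past renew_gt)

text \<open>Redrawing the future from its own law preserves the law. This takes the place of the
  tower property for the observations up to time \<open>n\<close>.\<close>

lemma
  assumes th: "\<And>k. k < K \<Longrightarrow> th k \<in> \<Theta>"
  shows nn_integral_renew: "g \<in> borel_measurable (PiM Idx (\<lambda>_. \<nu>)) \<Longrightarrow>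
      (\<integral>\<^sup>+ \<omega>. g \<omega> \<partial>P th) = (\<integral>\<^sup>+ \<omega>. (\<integral>\<^sup>+ \<omega>'. g (renew n \<omega> \<omega>') \<partial>P th) \<partial>P th)"
    and AE_renew: "AE \<omega> in P th. Q \<omega> \<Longrightarrow> AE \<omega> in P th. AE \<omega>' in P th. Q (renew n \<omega> \<omega>')"
proof -
  let ?M = "\<lambda>i. law (th (fst i))"
  have M: "\<And>i. i \<in> Idx \<Longrightarrow> prob_space (?M i)" using th law_prob by auto
  {
    assume "g \<in> borel_measurable (PiM Idx (\<lambda>_. \<nu>))"
    then have g: "g \<in> borel_measurable (PiM Idx ?M)"
      unfolding measurable_cong_sets[OF sets_P[of th] refl, unfolded P_eq] .
    have "(\<integral>\<^sup>+ \<omega>. g \<omega> \<partial>PiM Idx (\<lambda>i. if i \<in> future n then ?M i else ?M i))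
        = (\<integral>\<^sup>+ \<omega>. (\<integral>\<^sup>+ \<omega>'. g (renew n \<omega> \<omega>') \<partial>PiM Idx ?M) \<partial>PiM Idx ?M)"
      by (rule nn_integral_resample[where I=Idx and Q="?M" and Q'="?M" and S="future n" and g=g])
        (fact M | fact g | rule refl)+
    then show "(\<integral>\<^sup>+ \<omega>. g \<omega> \<partial>P th) = (\<integral>\<^sup>+ \<omega>. (\<integral>\<^sup>+ \<omega>'. g (renew n \<omega> \<omega>') \<partial>P th) \<partial>P th)"
      unfolding if_cancel P_eq .
  }
  assume "AE \<omega> in P th. Q \<omega>"
  then have "AE \<omega> in PiM Idx (\<lambda>i. if i \<in> future n then ?M i else ?M i). Q \<omega>"
    unfolding if_cancel P_eq .
  then have "AE \<omega> in PiM Idx ?M. AE \<omega>' in PiM Idx ?M. Q (renew n \<omega> \<omega>')"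
    by (rule AE_resample[where I=Idx and Q="?M" and Q'="?M" and S="future n" and P=Q, rotated 3])
      (fact M | rule refl)+
  then show "AE \<omega> in P th. AE \<omega>' in P th. Q (renew n \<omega> \<omega>')"
    unfolding P_eq .
qed

end

lemma prod_pos_imp_pos:
  fixes g :: "'a \<Rightarrow> real"
  assumes "(\<Prod>k\<in>A. g k) > 0" "finite A" "k \<in> A" "g k \<ge> 0"
  shows "g k > 0"
proof -
  have "g k \<noteq> 0" using assms prod_zero[of A g] by fastforce
  with assms show ?thesis by simp
qed

section \<open>Consequences of an almost surely positive plug-in likelihood\<close>

context plug_in_setup
begin

text \<open>Let the observations up to time \<open>n\<close> follow \<open>p\<close> and all later
  ones \<open>d\<close>. Only finitely many coordinates have changed against the law under
  \<open>d\<close>, so the plug-in likelihood at \<open>Suc n\<close> is still almost surely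
  positive; its last factors test estimates computed from \<open>p\<close> data on observations from
  \<open>d\<close>.\<close>

lemma thhat_dominates:
  assumes p: "p \<in> \<Theta>" and d: "d \<in> \<Theta>" and ac: "absolutely_continuous (law d) (law p)"
    and pos: "AE \<omega> in P (\<lambda>_. d). lhat (Suc n) \<omega> > 0"
  shows "AE \<omega> in P (\<lambda>_. p). \<forall>k<K. AE x in law d. f (thhat k n (stream \<omega> k)) x > 0"
proof -
  let ?S = "{..<K} \<times> {..n}"
  have pd: "prob_space (law p)" "prob_space (law d)" using p d law_prob by auto
  have s: "sets (law p) = sets (law d)" by simp
  have "AE \<omega> in PiM Idx (\<lambda>i. if i \<in> ?S then law p else law d). lhat (Suc n) \<omega> > 0"
  proof (rule AE_PiM_finite_change[where Q="\<lambda>_. law d" and Q'="\<lambda>_. law p" and I=Idx])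
    show "AE \<omega> in PiM Idx (\<lambda>_. law d). lhat (Suc n) \<omega> > 0" using pos unfolding P_eq .
  next
    fix i show "prob_space (law d)" "prob_space (law p)" by (fact pd)+
    show "sets (law p) = sets (law d)" by (rule s)
    show "absolutely_continuous (law d) (law p)" by (rule ac)
  next
    show "finite ?S" by (intro finite_cartesian_product) (rule finite_lessThan, rule finite_atMost)
    show "?S \<subseteq> Idx" by (intro Sigma_mono subset_UNIV subset_refl)
  qed
  \<comment> \<open>On \<open>Idx\<close> the complement of \<open>?S\<close> is
    \<open>future n\<close>; seen from the future, the mixed law has the form that
    \<open>AE_resample\<close> splits.\<close>
  moreover have "PiM Idx (\<lambda>i. if i \<in> ?S then law p else law d) = PiM Idx (\<lambda>i. if i \<in> future n then law d else law p)"
    by (intro PiM_cong) (auto simp: future_def)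
  ultimately have "AE \<omega> in PiM Idx (\<lambda>i. if i \<in> future n then law d else law p). lhat (Suc n) \<omega> > 0"
    by (simp only:)
  then have "AE \<omega> in PiM Idx (\<lambda>_. law p). AE \<omega>' in PiM Idx (\<lambda>_. law d). lhat (Suc n) (renew n \<omega> \<omega>') > 0"
    by (rule AE_resample[where I=Idx and Q="\<lambda>_. law p" and Q'="\<lambda>_. law d" and S="future n"
          and P="\<lambda>\<omega>. lhat (Suc n) \<omega> > 0", rotated 3])
       (rule pd s[symmetric])+
  then have ae: "AE \<omega> in P (\<lambda>_. p). AE \<omega>' in P (\<lambda>_. d). lhat (Suc n) (renew n \<omega> \<omega>') > 0"
    unfolding P_eq .
  show ?thesis
  proof (rule AE_mp[OF ae], rule AE_I2, intro impI allI)
    fix \<omega> k assume w: "AE \<omega>' in P (\<lambda>_. d). lhat (Suc n) (renew n \<omega> \<omega>') > 0" and k: "k < K"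
    have "AE \<omega>' in P (\<lambda>_. d). f (thhat k n (stream \<omega> k)) (\<omega>' (k, Suc n)) > 0"
    proof (rule AE_mp[OF w], rule AE_I2, rule impI)
      fix \<omega>' assume "lhat (Suc n) (renew n \<omega> \<omega>') > 0"
      then have "0 < (\<Prod>k<K. f (thhat k n (stream \<omega> k)) (\<omega>' (k, Suc n)))"
        using lhat_nonneg[of n \<omega>] by (auto simp: lhat_renew_Suc zero_less_mult_iff)
      then show "f (thhat k n (stream \<omega> k)) (\<omega>' (k, Suc n)) > 0"
        by (rule prod_pos_imp_pos) (use k in \<open>auto intro!: f_nonneg thhat_in\<close>)
    qed
    then show "AE x in law d. f (thhat k n (stream \<omega> k)) x > 0"
      using AE_P_component[where th="\<lambda>_. d" and k=k and \<theta>="thhat k n (stream \<omega> k)" and t="Suc n"] d k thhat_in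
      by blast
  qed
qed

text \<open>Let \<open>V\<close> be the log ratio of the competitor \<open>th'\<close> to the
  plug-in likelihood. Given the past, \<open>V\<close> falls by at most \<open>\<delta>\<close> per
  step on average, while \<open>fin\<close> allows it above the steeper line of slope
  \<open>-\<kappa>\<close> only with summable probability.\<close>

lemma no_summable_plug_in_win:
  assumes p: "p \<in> \<Theta>" and th': "\<And>k. k < K \<Longrightarrow> th' k \<in> \<Theta>"
    and used: "\<And>n. AE \<omega> in P (\<lambda>_. p). \<forall>k<K. ereal J \<le> KL \<nu> f p (thhat k n (stream \<omega> k))"
    and lpos: "\<And>n. AE \<omega> in P (\<lambda>_. p). lhat n \<omega> > 0"
    and thpos: "\<And>k. k < K \<Longrightarrow> AE x in law p. f (th' k) x > 0"
    and B2: "(\<Sum>k<K. \<integral>\<^sup>+ x. ennreal (llr f p (th' k) x) \<partial>law p)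
      \<le> ennreal (J + \<delta>) + (\<Sum>k<K. \<integral>\<^sup>+ x. ennreal (- llr f p (th' k) x) \<partial>law p)"
    and J: "0 \<le> J" and \<delta>: "0 \<le> \<delta>" "\<delta> < \<kappa>"
    and fin: "(\<Sum>n. emeasure (P (\<lambda>_. p)) {\<omega> \<in> space (P (\<lambda>_. p)). lhat n \<omega> < exp (real n * \<kappa>) * Lvec K f n th' \<omega>}) \<noteq> \<infinity>"
  shows False
proof -
  define M where "M = P (\<lambda>_. p)"
  interpret M: prob_space M unfolding M_def using p by (intro P_prob)
  have sM: "sets M = sets (PiM Idx (\<lambda>_. \<nu>))" unfolding M_def by (rule sets_P)
  define V where "V n \<omega> = ln (Lvec K f n th' \<omega> / lhat n \<omega>)" for n \<omega>
  have Vm0[measurable]: "V n \<in> borel_measurable (PiM Idx (\<lambda>_. \<nu>))" for n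
    using Lvec_meas[of th' n] th' unfolding V_def[abs_def] by measurable
  have Vm[measurable]: "V n \<in> borel_measurable M" for n
    using Vm0 unfolding measurable_cong_sets[OF sM refl] .
  have Vpast: "m \<le> n \<Longrightarrow> V m (renew n \<omega> \<omega>') = V m \<omega>" for m n \<omega> \<omega>'
    by (simp add: V_def renew_past)
  define C where "C = 2 * real K + J + \<delta>"
  have C: "C > 0" using K J \<delta> by (simp add: C_def)
  define s where "s t \<omega> k = thhat k t (stream \<omega> k)" for t \<omega> k
  \<comment> \<open>b minus a, as in \<open>nn_integral_sum_difference\<close>: the density of
    \<open>p\<close> is inserted as a common reference, which turns the step into log-likelihood
    ratios of the truth. The estimates \<open>s t \<omega>\<close> are fixed by the past; only the
    observations at time \<open>Suc t\<close> are random.\<close>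
  define bma where "bma t \<omega> \<omega>' = (\<Sum>k<K. llr f p (th' k) (\<omega>' (k, Suc t)) - llr f p (s t \<omega> k) (\<omega>' (k, Suc t)))"
    for t and \<omega> \<omega>' :: "nat \<times> nat \<Rightarrow> 'x"
  \<comment> \<open>Positivity of the likelihoods at time \<open>Suc t\<close> makes the logarithms
    additive; by \<open>AE_renew\<close> it holds for almost every future after almost every
    past.\<close>
  have key: "AE \<omega> in M. (\<forall>k<K. AE x in law p. f (s t \<omega> k) x > 0)
       \<and> (AE \<omega>' in M. V t (renew t \<omega> \<omega>') - V (Suc t) (renew t \<omega> \<omega>') = bma t \<omega> \<omega>')" for t
  proof -
    have "AE x in law p. f p x > 0" unfolding law_def using f_meas[OF p] by (subst AE_density) auto
    then have 3: "AE \<omega> in M. Lvec K f (Suc t) (\<lambda>_. p) \<omega> > 0"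
      unfolding M_def using p by (intro AE_Lvec_pos) auto
    have 2: "AE \<omega> in M. Lvec K f (Suc t) th' \<omega> > 0"
      unfolding M_def using p th' thpos by (intro AE_Lvec_pos) auto
    have "AE \<omega> in M. lhat (Suc t) \<omega> > 0 \<and> Lvec K f (Suc t) th' \<omega> > 0 \<and> Lvec K f (Suc t) (\<lambda>_. p) \<omega> > 0"
      using lpos[of "Suc t"] 2 3 unfolding M_def by simp
    then have ae: "AE \<omega> in M. AE \<omega>' in M. lhat (Suc t) (renew t \<omega> \<omega>') > 0
        \<and> Lvec K f (Suc t) th' (renew t \<omega> \<omega>') > 0 \<and> Lvec K f (Suc t) (\<lambda>_. p) (renew t \<omega> \<omega>') > 0"
      unfolding M_def using AE_renew[of "\<lambda>_. p"] p by blast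
    have eq: "V t (renew t \<omega> \<omega>') - V (Suc t) (renew t \<omega> \<omega>') = bma t \<omega> \<omega>'"
      if a: "lhat (Suc t) (renew t \<omega> \<omega>') > 0" "Lvec K f (Suc t) th' (renew t \<omega> \<omega>') > 0"
        "Lvec K f (Suc t) (\<lambda>_. p) (renew t \<omega> \<omega>') > 0" for \<omega> \<omega>'
    proof -
      define gs where "gs k = f (s t \<omega> k) (\<omega>' (k, Suc t))" for k
      define gt where "gt k = f (th' k) (\<omega>' (k, Suc t))" for k
      define gp where "gp k = f p (\<omega>' (k, Suc t))" for k
      have l: "lhat t \<omega> * (\<Prod>k<K. gs k) > 0" "Lvec K f t th' \<omega> * (\<Prod>k<K. gt k) > 0" "Lvec K f t (\<lambda>_. p) \<omega> * (\<Prod>k<K. gp k) > 0"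
        using a by (simp_all add: lhat_renew_Suc Lvec_renew_Suc gs_def gt_def gp_def s_def)
      have pos: "lhat t \<omega> > 0" "(\<Prod>k<K. gs k) > 0" "Lvec K f t th' \<omega> > 0" "(\<Prod>k<K. gt k) > 0" "(\<Prod>k<K. gp k) > 0"
        using l lhat_nonneg[of t \<omega>] Lvec_nonneg[where th=th' and n=t and \<omega>=\<omega>]
          Lvec_nonneg[where th="\<lambda>_. p" and n=t and \<omega>=\<omega>] p th'
        by (auto simp: zero_less_mult_iff)
      have g: "gs k > 0" "gt k > 0" "gp k > 0" if "k < K" for k
      proof -
        have "gs k \<ge> 0" "gt k \<ge> 0" "gp k \<ge> 0"
          unfolding gs_def gt_def gp_def s_def using that th' p by (auto intro!: f_nonneg thhat_in)
        then show "gs k > 0" "gt k > 0" "gp k > 0"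
          using that prod_pos_imp_pos[OF pos(2) finite_lessThan, of k] prod_pos_imp_pos[OF pos(4) finite_lessThan, of k]
            prod_pos_imp_pos[OF pos(5) finite_lessThan, of k] by auto
      qed
      have "V t (renew t \<omega> \<omega>') - V (Suc t) (renew t \<omega> \<omega>')
          = ln (Lvec K f t th' \<omega> / lhat t \<omega>) - ln ((Lvec K f t th' \<omega> * (\<Prod>k<K. gt k)) / (lhat t \<omega> * (\<Prod>k<K. gs k)))"
        unfolding V_def lhat_renew_Suc Lvec_renew_Suc by (simp add: renew_past gs_def gt_def s_def)
      also have "\<dots> = ln (\<Prod>k<K. gs k) - ln (\<Prod>k<K. gt k)"
      proof -
        have "ln (a / b) - ln (a * x / (b * y)) = ln y - ln x"
          if "a > 0" "b > 0" "x > 0" "y > 0" for a b x y :: real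
          using that by (simp add: ln_div ln_mult)
        then show ?thesis using pos by blast
      qed
      also have "\<dots> = (\<Sum>k<K. ln (gs k) - ln (gt k))"
        using g by (subst (1 2) ln_prod) (auto simp: sum_subtractf less_imp_neq[symmetric])
      also have "\<dots> = bma t \<omega> \<omega>'"
      proof -
        have "ln (gs k) - ln (gt k) = ln (gp k / gt k) - ln (gp k / gs k)" if "k < K" for k
          using g[OF that] by (simp add: ln_div)
        then show ?thesis unfolding bma_def llr_def gs_def gt_def gp_def by (intro sum.cong) auto
      qed
      finally show ?thesis .
    qed
    have used': "AE x in law p. f (s t \<omega> k) x > 0"
      if k: "k < K" and a: "AE \<omega>' in M. lhat (Suc t) (renew t \<omega> \<omega>') > 0" for \<omega> k
    proof -
      have "AE \<omega>' in M. f (s t \<omega> k) (\<omega>' (k, Suc t)) > 0"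
      proof (rule AE_mp[OF a], rule AE_I2, rule impI)
        fix \<omega>' assume "lhat (Suc t) (renew t \<omega> \<omega>') > 0"
        then have "0 < (\<Prod>k<K. f (thhat k t (stream \<omega> k)) (\<omega>' (k, Suc t)))"
          using lhat_nonneg[of t \<omega>] by (auto simp: lhat_renew_Suc zero_less_mult_iff)
        then have "f (thhat k t (stream \<omega> k)) (\<omega>' (k, Suc t)) > 0"
          by (rule prod_pos_imp_pos) (use k in \<open>auto intro!: f_nonneg thhat_in\<close>)
        then show "f (s t \<omega> k) (\<omega>' (k, Suc t)) > 0" by (simp add: s_def)
      qed
      then show ?thesis
        using AE_P_component[where th="\<lambda>_. p" and k=k and \<theta>="s t \<omega> k" and t="Suc t"] p k thhat_in
        unfolding s_def M_def by blast
    qed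
    show ?thesis
    proof (rule AE_mp[OF ae], rule AE_I2, rule impI, rule conjI)
      fix \<omega> assume a: "AE \<omega>' in M. lhat (Suc t) (renew t \<omega> \<omega>') > 0
        \<and> Lvec K f (Suc t) th' (renew t \<omega> \<omega>') > 0 \<and> Lvec K f (Suc t) (\<lambda>_. p) (renew t \<omega> \<omega>') > 0"
      show "AE \<omega>' in M. V t (renew t \<omega> \<omega>') - V (Suc t) (renew t \<omega> \<omega>') = bma t \<omega> \<omega>'"
        by (rule AE_mp[OF a], rule AE_I2, rule impI, rule eq) simp_all
      have "AE \<omega>' in M. lhat (Suc t) (renew t \<omega> \<omega>') > 0"
        by (rule AE_mp[OF a], rule AE_I2) simp
      then show "\<forall>k<K. AE x in law p. f (s t \<omega> k) x > 0" using used' by blast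
    qed
  qed
  have comp: "(\<integral>\<^sup>+ \<omega>'. g (\<omega>' (k, Suc t)) \<partial>M) = (\<integral>\<^sup>+ x. g x \<partial>law p)"
    if "k < K" "g \<in> borel_measurable \<nu>" for g k t
    unfolding M_def P_eq using that law_prob[OF p] by (intro nn_integral_PiM_component) auto
  have inner: "(\<integral>\<^sup>+ \<omega>'. ennreal (V t (renew t \<omega> \<omega>') - V (Suc t) (renew t \<omega> \<omega>')) \<partial>M) \<le> ennreal C
      \<and> (\<integral>\<^sup>+ \<omega>'. ennreal (V t (renew t \<omega> \<omega>') - V (Suc t) (renew t \<omega> \<omega>')) \<partial>M)
        \<le> (\<integral>\<^sup>+ \<omega>'. ennreal (V (Suc t) (renew t \<omega> \<omega>') - V t (renew t \<omega> \<omega>')) \<partial>M) + ennreal \<delta>"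
    if s: "\<forall>k<K. AE x in law p. f (s t \<omega> k) x > 0"
      and KL: "\<forall>k<K. ereal J \<le> KL \<nu> f p (s t \<omega> k)"
      and eq: "AE \<omega>' in M. V t (renew t \<omega> \<omega>') - V (Suc t) (renew t \<omega> \<omega>') = bma t \<omega> \<omega>'" for t \<omega>
  proof -
    have sT: "s t \<omega> k \<in> \<Theta>" if "k < K" for k using that by (simp add: s_def thhat_in)
    have lm[measurable]: "llr f p q \<in> borel_measurable \<nu>" if "q \<in> \<Theta>" for q
      using that p by (intro llr_measurable dens)
    let ?a = "\<lambda>k \<omega>'. llr f p (s t \<omega> k) (\<omega>' (k, Suc t))"
    let ?b = "\<lambda>k \<omega>'. llr f p (th' k) (\<omega>' (k, Suc t))"
    have meas: "(\<lambda>\<omega>'. llr f p q (\<omega>' (k, Suc t))) \<in> borel_measurable M" if "q \<in> \<Theta>" "k < K" for q k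
    proof -
      have "(\<lambda>\<omega>'. \<omega>' (k, Suc t)) \<in> measurable (PiM Idx (\<lambda>_. \<nu>)) \<nu>"
        using that by (intro measurable_component_singleton) auto
      from measurable_compose[OF this lm[OF that(1)]] show ?thesis
        unfolding measurable_cong_sets[OF sM refl] .
    qed
    have e1: "(\<integral>\<^sup>+ \<omega>'. ennreal (V t (renew t \<omega> \<omega>') - V (Suc t) (renew t \<omega> \<omega>')) \<partial>M)
        = (\<integral>\<^sup>+ \<omega>'. ennreal (\<Sum>k<K. ?b k \<omega>' - ?a k \<omega>') \<partial>M)"
      by (rule nn_integral_cong_AE, rule AE_mp[OF eq], rule AE_I2) (simp add: bma_def)
    have e2: "(\<integral>\<^sup>+ \<omega>'. ennreal (V (Suc t) (renew t \<omega> \<omega>') - V t (renew t \<omega> \<omega>')) \<partial>M)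
        = (\<integral>\<^sup>+ \<omega>'. ennreal (\<Sum>k<K. ?a k \<omega>' - ?b k \<omega>') \<partial>M)"
    proof (rule nn_integral_cong_AE, rule AE_mp[OF eq], rule AE_I2, rule impI)
      fix \<omega>' assume e: "V t (renew t \<omega> \<omega>') - V (Suc t) (renew t \<omega> \<omega>') = bma t \<omega> \<omega>'"
      have "V (Suc t) (renew t \<omega> \<omega>') - V t (renew t \<omega> \<omega>') = - bma t \<omega> \<omega>'" using e by linarith
      also have "\<dots> = (\<Sum>k<K. ?a k \<omega>' - ?b k \<omega>')" unfolding bma_def by (simp add: sum_negf[symmetric])
      finally show "ennreal (V (Suc t) (renew t \<omega> \<omega>') - V t (renew t \<omega> \<omega>')) = ennreal (\<Sum>k<K. ?a k \<omega>' - ?b k \<omega>')"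
        by simp
    qed
    have ci: "(\<integral>\<^sup>+ \<omega>'. ennreal (llr f p q (\<omega>' (k, Suc t))) \<partial>M) = (\<integral>\<^sup>+ x. ennreal (llr f p q x) \<partial>law p)"
      "(\<integral>\<^sup>+ \<omega>'. ennreal (- llr f p q (\<omega>' (k, Suc t))) \<partial>M) = (\<integral>\<^sup>+ x. ennreal (- llr f p q x) \<partial>law p)"
      if "k < K" "q \<in> \<Theta>" for k q
      using that lm[OF that(2)] comp[of k "\<lambda>x. ennreal (llr f p q x)"] comp[of k "\<lambda>x. ennreal (- llr f p q x)"]
      by auto
    have A1: "(\<integral>\<^sup>+ \<omega>'. ennreal (- ?a k \<omega>') \<partial>M) \<le> 1" if "k < K" for k
      using llr_neg_integral_le_1[OF dens[OF p] dens[OF sT[OF that]]] s[unfolded law_def] that unfolding ci[OF that sT[OF that]] law_def by blast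
    have B1: "(\<integral>\<^sup>+ \<omega>'. ennreal (- ?b k \<omega>') \<partial>M) \<le> 1" if "k < K" for k
      using llr_neg_integral_le_1[OF dens[OF p] dens[OF th'[OF that]]] thpos[OF that, unfolded law_def] unfolding ci[OF that th'[OF that]] law_def by blast
    have A2: "ennreal J + (\<integral>\<^sup>+ \<omega>'. ennreal (- ?a k \<omega>') \<partial>M) \<le> (\<integral>\<^sup>+ \<omega>'. ennreal (?a k \<omega>') \<partial>M)" if "k < K" for k
      using llr_integral_lower[OF dens[OF p] dens[OF sT[OF that]] _ _ J] s[unfolded law_def] KL that unfolding ci[OF that sT[OF that]] law_def by blast
    have B2': "(\<Sum>k<K. \<integral>\<^sup>+ \<omega>'. ennreal (?b k \<omega>') \<partial>M) \<le> ennreal (J + \<delta>) + (\<Sum>k<K. \<integral>\<^sup>+ \<omega>'. ennreal (- ?b k \<omega>') \<partial>M)"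
      using B2 by (simp add: ci th')
    have "(\<integral>\<^sup>+ \<omega>'. ennreal (\<Sum>k<K. ?b k \<omega>' - ?a k \<omega>') \<partial>M) \<le> ennreal (2 * real K + J + \<delta>)"
      by (rule nn_integral_sum_difference(1)) (assumption | rule A1 B1 A2 B2' J \<delta>(1) K meas sT th')+
    moreover have "(\<integral>\<^sup>+ \<omega>'. ennreal (\<Sum>k<K. ?b k \<omega>' - ?a k \<omega>') \<partial>M) \<le> (\<integral>\<^sup>+ \<omega>'. ennreal (\<Sum>k<K. ?a k \<omega>' - ?b k \<omega>') \<partial>M) + ennreal \<delta>"
      by (rule nn_integral_sum_difference(2)) (assumption | rule A1 B1 A2 B2' J \<delta>(1) K meas sT th')+
    ultimately show ?thesis unfolding e1 e2 C_def by blast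
  qed
  have AEinner: "AE \<omega> in M. (\<integral>\<^sup>+ \<omega>'. ennreal (V t (renew t \<omega> \<omega>') - V (Suc t) (renew t \<omega> \<omega>')) \<partial>M) \<le> ennreal C
      \<and> (\<integral>\<^sup>+ \<omega>'. ennreal (V t (renew t \<omega> \<omega>') - V (Suc t) (renew t \<omega> \<omega>')) \<partial>M)
        \<le> (\<integral>\<^sup>+ \<omega>'. ennreal (V (Suc t) (renew t \<omega> \<omega>') - V t (renew t \<omega> \<omega>')) \<partial>M) + ennreal \<delta>" for t
    by (rule AE_mp[OF key[of t]], rule AE_mp[OF used[of t, folded M_def]], rule AE_I2, intro impI, rule inner)
       (auto simp: s_def)
  have renewM: "(\<integral>\<^sup>+ \<omega>. g \<omega> \<partial>M) = (\<integral>\<^sup>+ \<omega>. (\<integral>\<^sup>+ \<omega>'. g (renew n \<omega> \<omega>') \<partial>M) \<partial>M)"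
    if "g \<in> borel_measurable M" for g n
    using that[unfolded measurable_cong_sets[OF sM refl]] p nn_integral_renew[of "\<lambda>_. p" g n]
    unfolding M_def by blast
  show False
  proof (rule M.no_summable_crossing_with_drift[of V C \<delta> \<kappa>])
    show "V n \<in> borel_measurable M" for n by (rule Vm)
    show "V 0 \<omega> = 0" for \<omega> by (simp add: V_def Lvec_def Lik_def lhat_def)
    show "0 < C" "0 \<le> \<delta>" "\<delta> < \<kappa>" by fact+
    show "(\<integral>\<^sup>+ \<omega>. indicator {\<omega>\<in>space M. V N \<omega> > c} \<omega> * ennreal (V t \<omega> - V (Suc t) \<omega>) \<partial>M)
         \<le> ennreal C * emeasure M {\<omega>\<in>space M. V N \<omega> > c}" if Nt: "N \<le> t" for N t c
    proof -
      let ?A = "{\<omega>\<in>space M. V N \<omega> > c}"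
      have Am: "?A \<in> sets M" by measurable
      have "(\<integral>\<^sup>+ \<omega>. indicator ?A \<omega> * ennreal (V t \<omega> - V (Suc t) \<omega>) \<partial>M)
          = (\<integral>\<^sup>+ \<omega>. (\<integral>\<^sup>+ \<omega>'. indicator ?A (renew t \<omega> \<omega>') * ennreal (V t (renew t \<omega> \<omega>') - V (Suc t) (renew t \<omega> \<omega>')) \<partial>M) \<partial>M)"
        by (rule renewM) measurable
      also have "\<dots> \<le> (\<integral>\<^sup>+ \<omega>. ennreal C * indicator ?A \<omega> \<partial>M)"
      proof (rule nn_integral_mono_AE, rule AE_mp[OF AEinner[of t]], rule AE_I2, rule impI)
        fix \<omega> assume w: "\<omega> \<in> space M" and i: "(\<integral>\<^sup>+ \<omega>'. ennreal (V t (renew t \<omega> \<omega>') - V (Suc t) (renew t \<omega> \<omega>')) \<partial>M) \<le> ennreal C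
          \<and> (\<integral>\<^sup>+ \<omega>'. ennreal (V t (renew t \<omega> \<omega>') - V (Suc t) (renew t \<omega> \<omega>')) \<partial>M)
            \<le> (\<integral>\<^sup>+ \<omega>'. ennreal (V (Suc t) (renew t \<omega> \<omega>') - V t (renew t \<omega> \<omega>')) \<partial>M) + ennreal \<delta>"
        have "(\<integral>\<^sup>+ \<omega>'. indicator ?A (renew t \<omega> \<omega>') * ennreal (V t (renew t \<omega> \<omega>') - V (Suc t) (renew t \<omega> \<omega>')) \<partial>M)
            = (\<integral>\<^sup>+ \<omega>'. indicator ?A \<omega> * ennreal (V t (renew t \<omega> \<omega>') - V (Suc t) (renew t \<omega> \<omega>')) \<partial>M)"
        proof (rule nn_integral_cong)
          fix \<omega>' assume w': "\<omega>' \<in> space M"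
          have "renew t \<omega> \<omega>' \<in> space M" using w w' renew_space unfolding M_def by blast
          \<comment> \<open>The event is decided by time \<open>N \<le> t\<close>, so it is constant
            in the redrawn future and leaves the inner integral.\<close>
          then have "(indicator ?A (renew t \<omega> \<omega>') :: ennreal) = indicator ?A \<omega>"
            using w Vpast[OF Nt] by (simp add: indicator_def)
          then show "indicator ?A (renew t \<omega> \<omega>') * ennreal (V t (renew t \<omega> \<omega>') - V (Suc t) (renew t \<omega> \<omega>'))
              = indicator ?A \<omega> * ennreal (V t (renew t \<omega> \<omega>') - V (Suc t) (renew t \<omega> \<omega>'))" by (simp only:)
        qed
        also have "\<dots> \<le> ennreal C * indicator ?A \<omega>"
          using i by (cases "\<omega> \<in> ?A") auto
        finally show "(\<integral>\<^sup>+ \<omega>'. indicator ?A (renew t \<omega> \<omega>') * ennreal (V t (renew t \<omega> \<omega>') - V (Suc t) (renew t \<omega> \<omega>')) \<partial>M)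
            \<le> ennreal C * indicator ?A \<omega>" .
      qed
      also have "\<dots> = ennreal C * emeasure M ?A" using Am by (rule nn_integral_cmult_indicator)
      finally show ?thesis .
    qed
    show "(\<integral>\<^sup>+ \<omega>. ennreal (V t \<omega> - V (Suc t) \<omega>) \<partial>M)
       \<le> (\<integral>\<^sup>+ \<omega>. ennreal (V (Suc t) \<omega> - V t \<omega>) \<partial>M) + ennreal \<delta>" for t
    proof -
      have [measurable]: "(\<lambda>\<omega>. \<integral>\<^sup>+ \<omega>'. ennreal (V (Suc t) (renew t \<omega> \<omega>') - V t (renew t \<omega> \<omega>')) \<partial>M) \<in> borel_measurable M"
      proof -
        have "(\<lambda>(\<omega>, \<omega>'). renew t \<omega> \<omega>') \<in> measurable (M \<Otimes>\<^sub>M M) M"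
          unfolding M_def P_eq by (rule measurable_resample) auto
        from measurable_compose[OF this, of "\<lambda>\<omega>. ennreal (V (Suc t) \<omega> - V t \<omega>)" borel]
        have "(\<lambda>p. ennreal (V (Suc t) (case p of (\<omega>, \<omega>') \<Rightarrow> renew t \<omega> \<omega>') - V t (case p of (\<omega>, \<omega>') \<Rightarrow> renew t \<omega> \<omega>')))
            \<in> borel_measurable (M \<Otimes>\<^sub>M M)" by simp
        then show ?thesis by (intro M.borel_measurable_nn_integral) (simp add: case_prod_beta')
      qed
      have "(\<integral>\<^sup>+ \<omega>. ennreal (V t \<omega> - V (Suc t) \<omega>) \<partial>M)
          = (\<integral>\<^sup>+ \<omega>. (\<integral>\<^sup>+ \<omega>'. ennreal (V t (renew t \<omega> \<omega>') - V (Suc t) (renew t \<omega> \<omega>')) \<partial>M) \<partial>M)"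
        by (rule renewM) measurable
      also have "\<dots> \<le> (\<integral>\<^sup>+ \<omega>. (\<integral>\<^sup>+ \<omega>'. ennreal (V (Suc t) (renew t \<omega> \<omega>') - V t (renew t \<omega> \<omega>')) \<partial>M) + ennreal \<delta> \<partial>M)"
        by (rule nn_integral_mono_AE, rule AE_mp[OF AEinner[of t]], rule AE_I2) blast
      also have "\<dots> = (\<integral>\<^sup>+ \<omega>. (\<integral>\<^sup>+ \<omega>'. ennreal (V (Suc t) (renew t \<omega> \<omega>') - V t (renew t \<omega> \<omega>')) \<partial>M) \<partial>M) + ennreal \<delta>"
        by (subst nn_integral_add) (auto simp: M.emeasure_space_1)
      also have "(\<integral>\<^sup>+ \<omega>. (\<integral>\<^sup>+ \<omega>'. ennreal (V (Suc t) (renew t \<omega> \<omega>') - V t (renew t \<omega> \<omega>')) \<partial>M) \<partial>M)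
          = (\<integral>\<^sup>+ \<omega>. ennreal (V (Suc t) \<omega> - V t \<omega>) \<partial>M)"
        by (rule renewM[symmetric]) measurable
      finally show ?thesis .
    qed
    have ms: "{\<omega> \<in> space M. lhat n \<omega> < exp (real n * \<kappa>) * Lvec K f n th' \<omega>} \<in> sets M" for n
    proof -
      have [measurable]: "lhat n \<in> borel_measurable M" "Lvec K f n th' \<in> borel_measurable M"
        using Lvec_meas[of th' n] th' unfolding measurable_cong_sets[OF sM refl] by auto
      show ?thesis by measurable
    qed
    have "emeasure M {\<omega>\<in>space M. V n \<omega> > - (real n * \<kappa>)} \<le> emeasure M {\<omega> \<in> space M. lhat n \<omega> < exp (real n * \<kappa>) * Lvec K f n th' \<omega>}" for n
    proof (rule emeasure_mono_AE[OF _ ms])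
      have 2: "AE \<omega> in M. Lvec K f n th' \<omega> > 0"
        unfolding M_def using p th' thpos by (intro AE_Lvec_pos) auto
      show "AE \<omega> in M. \<omega> \<in> {\<omega>\<in>space M. V n \<omega> > - (real n * \<kappa>)} \<longrightarrow> \<omega> \<in> {\<omega> \<in> space M. lhat n \<omega> < exp (real n * \<kappa>) * Lvec K f n th' \<omega>}"
      proof (rule AE_mp[OF 2], rule AE_mp[OF lpos[of n, folded M_def]], rule AE_I2, intro impI)
        fix \<omega> assume a: "\<omega> \<in> space M" "lhat n \<omega> > 0" "Lvec K f n th' \<omega> > 0" "\<omega> \<in> {\<omega>\<in>space M. V n \<omega> > - (real n * \<kappa>)}"
        then have "ln (Lvec K f n th' \<omega>) - ln (lhat n \<omega>) > - (real n * \<kappa>)" by (simp add: V_def ln_div)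
        then have "ln (lhat n \<omega>) < real n * \<kappa> + ln (Lvec K f n th' \<omega>)" by simp
        then have "exp (ln (lhat n \<omega>)) < exp (real n * \<kappa> + ln (Lvec K f n th' \<omega>))" by (simp only: exp_less_cancel_iff)
        then have "lhat n \<omega> < exp (real n * \<kappa>) * Lvec K f n th' \<omega>" using a by (simp add: exp_add)
        then show "\<omega> \<in> {\<omega> \<in> space M. lhat n \<omega> < exp (real n * \<kappa>) * Lvec K f n th' \<omega>}" using a by simp
      qed
    qed
    then have "(\<Sum>n. emeasure M {\<omega>\<in>space M. V n \<omega> > - (real n * \<kappa>)})
        \<le> (\<Sum>n. emeasure M {\<omega> \<in> space M. lhat n \<omega> < exp (real n * \<kappa>) * Lvec K f n th' \<omega>})"
      by (intro suminf_le) auto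
    then show "(\<Sum>n. emeasure M {\<omega>\<in>space M. V n \<omega> > - (real n * \<kappa>)}) \<noteq> \<infinity>"
      using fin unfolding M_def by (auto simp: top_unique)
  qed
qed

text \<open>\<open>S\<close> will be the hypothesis opposite to \<open>p\<close>. A member
  \<open>q\<close> within \<open>J / 4\<close> of the infimum, placed in stream 0 only, gives a
  competitor that loses at most \<open>J + J / 4\<close> per step over all streams. The rate
  \<open>J / 2\<close> in \<open>fin\<close> is what (C) with tolerance \<open>J / 2\<close>
  supplies; it exceeds the slack \<open>J / 4\<close>.\<close>

lemma competitor_side_absurd:
  assumes p: "p \<in> \<Theta>" and S: "S \<subseteq> \<Theta>"
    and used: "\<And>n. AE \<omega> in P (\<lambda>_. p). \<forall>k<K. thhat k n (stream \<omega> k) \<in> S"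
    and lpos: "\<And>n. AE \<omega> in P (\<lambda>_. p). lhat n \<omega> > 0"
    and J: "(INF s\<in>S. KL \<nu> f p s) = ereal J" "J > 0"
    and fin: "\<And>q. q \<in> S \<Longrightarrow> AE x in law p. f q x > 0 \<Longrightarrow>
      (\<Sum>n. emeasure (P (\<lambda>_. p)) {\<omega> \<in> space (P (\<lambda>_. p)).
          lhat n \<omega> < exp (real n * (J / 2)) * Lvec K f n (\<lambda>k. if k = 0 then q else p) \<omega>}) \<noteq> \<infinity>"
  shows False
proof -
  have "(INF s\<in>S. KL \<nu> f p s) < ereal (J + J / 4)" using J by simp
  then obtain q where q: "q \<in> S" "KL \<nu> f p q < ereal (J + J / 4)" by (auto simp: INF_less_iff)
  have qT: "q \<in> \<Theta>" using q S by auto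
  have qpos: "AE x in law p. f q x > 0"
    unfolding law_def using q by (intro AE_pos_of_KL_finite dens p qT) auto
  have ppos: "AE x in law p. f p x > 0" unfolding law_def using f_meas[OF p] by (subst AE_density) auto
  define th' where "th' k = (if k = 0 then q else p)" for k :: nat
  have th'_eq: "(\<lambda>k. if k = 0 then q else p) = th'" by (simp add: th'_def fun_eq_iff)
  show False
  proof (rule no_summable_plug_in_win[of p th' J "J / 4" "J / 2"])
    show "p \<in> \<Theta>" by fact
    show "th' k \<in> \<Theta>" for k using qT p by (simp add: th'_def)
    have "ereal J \<le> KL \<nu> f p s" if "s \<in> S" for s
      using INF_lower[OF that, of "KL \<nu> f p"] J by simp
    then show "AE \<omega> in P (\<lambda>_. p). \<forall>k<K. ereal J \<le> KL \<nu> f p (thhat k n (stream \<omega> k))" for n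
      by - (rule AE_mp[OF used[of n]], rule AE_I2, blast)
    show "AE \<omega> in P (\<lambda>_. p). lhat n \<omega> > 0" for n by fact
    show "AE x in law p. f (th' k) x > 0" for k using qpos ppos by (cases "k = 0") (simp_all add: th'_def)
    show "(\<Sum>k<K. \<integral>\<^sup>+ x. ennreal (llr f p (th' k) x) \<partial>law p)
      \<le> ennreal (J + J / 4) + (\<Sum>k<K. \<integral>\<^sup>+ x. ennreal (- llr f p (th' k) x) \<partial>law p)"
    proof -
      have llr0: "llr f p p x = 0" for x by (simp add: llr_def)
      have "(\<integral>\<^sup>+ x. ennreal (llr f p (th' k) x) \<partial>law p) = (if k = 0 then \<integral>\<^sup>+ x. ennreal (llr f p q x) \<partial>law p else 0)"
        "(\<integral>\<^sup>+ x. ennreal (- llr f p (th' k) x) \<partial>law p) = (if k = 0 then \<integral>\<^sup>+ x. ennreal (- llr f p q x) \<partial>law p else 0)" for k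
        by (auto simp: th'_def llr0)
      moreover have "(\<integral>\<^sup>+ x. ennreal (llr f p q x) \<partial>law p) \<le> ennreal (J + J / 4) + (\<integral>\<^sup>+ x. ennreal (- llr f p q x) \<partial>law p)"
        unfolding law_def using q J by (intro llr_integral_upper dens p qT) auto
      ultimately show ?thesis using K by (simp add: sum.delta)
    qed
    show "(\<Sum>n. emeasure (P (\<lambda>_. p)) {\<omega> \<in> space (P (\<lambda>_. p)).
          lhat n \<omega> < exp (real n * (J / 2)) * Lvec K f n th' \<omega>}) \<noteq> \<infinity>"
      using fin[OF q(1) qpos] unfolding th'_eq .
  qed (use J in auto)
qed

end

section \<open>Condition (C) excludes two infinite separations\<close>

locale streams_test = plug_in_setup K \<nu> f "\<Theta>0 \<union> \<Theta>1" thhat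
  for K :: nat and \<nu> :: "'x measure" and f :: "'p \<Rightarrow> 'x \<Rightarrow> real" and \<Theta>0 \<Theta>1 :: "'p set"
    and thhat :: "nat \<Rightarrow> nat \<Rightarrow> (nat \<Rightarrow> 'x) \<Rightarrow> 'p" +
  assumes ne0: "\<Theta>0 \<noteq> {}" and ne1: "\<Theta>1 \<noteq> {}" and disj: "\<Theta>0 \<inter> \<Theta>1 = {}"
    and sep0: "\<And>t0. t0 \<in> \<Theta>0 \<Longrightarrow> (INF t\<in>\<Theta>1. KL \<nu> f t0 t) > 0"
    and sep1: "\<And>t1. t1 \<in> \<Theta>1 \<Longrightarrow> (INF t\<in>\<Theta>0. KL \<nu> f t1 t) > 0"
    and L0_meas: "\<And>n. Lbold0 K f \<Theta>0 \<Theta>1 n \<in> borel_measurable (PiM ({..<K} \<times> UNIV) (\<lambda>_. \<nu>))"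
    and L1_meas: "\<And>n. Lbold1 K f \<Theta>0 \<Theta>1 n \<in> borel_measurable (PiM ({..<K} \<times> UNIV) (\<lambda>_. \<nu>))"
    and C: "cond_C K \<nu> f \<Theta>0 \<Theta>1 thhat"
begin

abbreviation "J0 \<equiv> I0 K \<nu> f \<Theta>0 \<Theta>1"
abbreviation "J1 \<equiv> I1 K \<nu> f \<Theta>0 \<Theta>1"
abbreviation "A \<equiv> Ahat K f \<Theta>0 \<Theta>1"
abbreviation "L0 \<equiv> Lbold0 K f \<Theta>0 \<Theta>1"
abbreviation "L1 \<equiv> Lbold1 K f \<Theta>0 \<Theta>1"
abbreviation "bold \<equiv> Theta_bold K \<Theta>0 \<Theta>1"
abbreviation "sig \<equiv> signal_set K \<Theta>1"

definition bad0 where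
  "bad0 th \<epsilon> n = C_event (P th) (J0 th) \<epsilon> n (\<lambda>\<omega>. Lhat K f thhat n \<omega> / L0 n \<omega>)"
definition bad1 where
  "bad1 th \<epsilon> n = C_event (P th) (J1 th) \<epsilon> n (\<lambda>\<omega>. Lhat K f thhat n \<omega> / L1 n \<omega>)"

lemma bad_summable:
  assumes "th \<in> bold" "\<epsilon> > 0"
  shows "summable (\<lambda>n. measure (P th) (bad0 th \<epsilon> (Suc n)))" "summable (\<lambda>n. measure (P th) (bad1 th \<epsilon> (Suc n)))"
  using C assms by (auto simp: cond_C_def bad0_def bad1_def)

lemma C_event_sets:
  assumes [measurable]: "R \<in> borel_measurable M"
  shows "C_event M I \<epsilon> n R \<in> sets M"
  unfolding C_event_def by (cases "I = \<infinity>") simp_all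

lemma bad_sets: "bad0 th \<epsilon> n \<in> sets (P th)" "bad1 th \<epsilon> n \<in> sets (P th)"
  using L0_meas[of n] L1_meas[of n] Lhat_meas[of n] measurable_cong_sets[OF sets_P[of th] refl, of borel]
  unfolding bad0_def bad1_def by (auto intro!: C_event_sets borel_measurable_divide_ennreal)

lemma bold_in: "th \<in> bold \<Longrightarrow> k < K \<Longrightarrow> th k \<in> \<Theta>0 \<union> \<Theta>1"
  by (auto simp: Theta_bold_def)

lemma const_in_bold: "\<theta> \<in> \<Theta>0 \<union> \<Theta>1 \<Longrightarrow> (\<lambda>_. \<theta>) \<in> bold"
  using ne0 ne1 disj by (auto simp: Theta_bold_def)

lemma sig_const: "\<theta> \<in> \<Theta>1 \<Longrightarrow> sig (\<lambda>_. \<theta>) = {..<K}" "\<theta> \<in> \<Theta>0 \<Longrightarrow> sig (\<lambda>_. \<theta>) = {}"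
  using disj by (auto simp: signal_set_def)

lemma A_subset: "A n \<omega> \<subseteq> {..<K}" by (auto simp: Ahat_def)

lemma le_L0: "th' \<in> bold \<Longrightarrow> sig th' - A n \<omega> \<noteq> {} \<Longrightarrow> ennreal (Lvec K f n th' \<omega>) \<le> L0 n \<omega>"
  unfolding Lbold0_def by (intro SUP_upper) auto

lemma le_L1: "th' \<in> bold \<Longrightarrow> A n \<omega> - sig th' \<noteq> {} \<Longrightarrow> ennreal (Lvec K f n th' \<omega>) \<le> L1 n \<omega>"
  unfolding Lbold1_def by (intro SUP_upper) auto

lemma ratio_top_imp: "Lhat K f thhat n \<omega> / B = \<top> \<Longrightarrow> B = 0"
  by (simp add: Lhat_eq ennreal_divide_eq_top_iff)

section \<open>Lower bounds for the two separations\<close>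

lemma KL_le_KLvec:
  assumes th: "th \<in> bold" "th' \<in> bold" and k: "k < K"
  shows "KL \<nu> f (th k) (th' k) \<le> KLvec K \<nu> f th th'"
proof -
  have nn: "0 \<le> KL \<nu> f (th j) (th' j)" if "j < K" for j
    using that th bold_in by (intro KL_nonneg dens) auto
  have "KLvec K \<nu> f th th' = KL \<nu> f (th k) (th' k) + (\<Sum>j\<in>{..<K} - {k}. KL \<nu> f (th j) (th' j))"
    unfolding KLvec_def using k by (intro sum.remove) auto
  moreover have "0 \<le> (\<Sum>j\<in>{..<K} - {k}. KL \<nu> f (th j) (th' j))" using nn by (intro sum_nonneg) auto
  ultimately show ?thesis by (simp add: add_increasing2)
qed

text \<open>A competitor with an additional signal differs from \<open>th\<close> in some noise
  stream, and that single term of \<open>KLvec\<close> already reaches the infimum. If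
  \<open>th\<close> has no noise stream there is no competitor, so \<open>t0\<close> may be any
  parameter.\<close>

lemma I0_lower:
  assumes th: "th \<in> bold" and t0: "\<And>k. k < K \<Longrightarrow> th k \<in> \<Theta>0 \<Longrightarrow> th k = t0"
  shows "(INF s\<in>\<Theta>1. KL \<nu> f t0 s) \<le> J0 th"
  unfolding I0_def
proof (rule Inf_greatest, clarify)
  fix th' assume th': "th' \<in> bold" and "sig th' - sig th \<noteq> {}"
  then obtain k where k: "k < K" "th' k \<in> \<Theta>1" "th k \<notin> \<Theta>1" by (auto simp: signal_set_def)
  then have "th k = t0" using t0[of k] bold_in[OF th k(1)] by auto
  then have "(INF s\<in>\<Theta>1. KL \<nu> f t0 s) \<le> KL \<nu> f (th k) (th' k)" using k by (auto intro: INF_lower)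
  also have "\<dots> \<le> KLvec K \<nu> f th th'" using th th' k by (intro KL_le_KLvec)
  finally show "(INF s\<in>\<Theta>1. KL \<nu> f t0 s) \<le> KLvec K \<nu> f th th'" .
qed

lemma I1_lower:
  assumes th: "th \<in> bold" and t1: "\<And>k. k < K \<Longrightarrow> th k \<in> \<Theta>1 \<Longrightarrow> th k = t1"
  shows "(INF s\<in>\<Theta>0. KL \<nu> f t1 s) \<le> J1 th"
  unfolding I1_def
proof (rule Inf_greatest, clarify)
  fix th' assume th': "th' \<in> bold" and "sig th - sig th' \<noteq> {}"
  then obtain k where k: "k < K" "th k \<in> \<Theta>1" "th' k \<notin> \<Theta>1" by (auto simp: signal_set_def)
  then have "th k = t1" "th' k \<in> \<Theta>0" using t1[of k] bold_in[OF th' k(1)] by auto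
  then have "(INF s\<in>\<Theta>0. KL \<nu> f t1 s) \<le> KL \<nu> f (th k) (th' k)" by (auto intro: INF_lower)
  also have "\<dots> \<le> KLvec K \<nu> f th th'" using th th' k by (intro KL_le_KLvec)
  finally show "(INF s\<in>\<Theta>0. KL \<nu> f t1 s) \<le> KLvec K \<nu> f th th'" .
qed

lemma I_pos:
  assumes th: "th \<in> bold"
  shows "J0 th > 0" "J1 th > 0"
proof -
  obtain t0 t1 where t: "t0 \<in> \<Theta>0" "t1 \<in> \<Theta>1"
    "\<And>k. k < K \<Longrightarrow> (th k \<in> \<Theta>0 \<longrightarrow> th k = t0) \<and> (th k \<in> \<Theta>1 \<longrightarrow> th k = t1)"
    using th by (auto simp: Theta_bold_def)
  show "J0 th > 0" using sep0[OF t(1)] I0_lower[OF th, of t0] t(3) by (auto simp: less_le_trans)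
  show "J1 th > 0" using sep1[OF t(2)] I1_lower[OF th, of t1] t(3) by (auto simp: less_le_trans)
qed

lemma I_const_infinite:
  shows "\<theta> \<in> \<Theta>1 \<Longrightarrow> J0 (\<lambda>_. \<theta>) = \<infinity>" "\<theta> \<in> \<Theta>0 \<Longrightarrow> J1 (\<lambda>_. \<theta>) = \<infinity>"
proof -
  assume "\<theta> \<in> \<Theta>1"
  then have "sig th' - sig (\<lambda>_. \<theta>) = {}" for th' by (auto simp: signal_set_def)
  then show "J0 (\<lambda>_. \<theta>) = \<infinity>" by (simp add: I0_def top_ereal_def)
next
  assume "\<theta> \<in> \<Theta>0"
  then have "sig (\<lambda>_. \<theta>) - sig th' = {}" for th' by (simp add: sig_const)
  then show "J1 (\<lambda>_. \<theta>) = \<infinity>" by (simp add: I1_def top_ereal_def)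
qed

text \<open>A vanished plug-in likelihood stays zero and makes the ratio 0, which puts the sample
  into \<open>bad0\<close> at every later time. By (C) these probabilities tend to 0.\<close>

lemma lhat_pos:
  assumes th: "th \<in> bold"
  shows "AE \<omega> in P th. lhat n \<omega> > 0"
proof -
  interpret P: prob_space "P th" using th bold_in by (intro P_prob) auto
  let ?Z = "{\<omega> \<in> space (P th). lhat n \<omega> = 0}"
  have zero: "lhat m \<omega> = 0" if "n \<le> m" "lhat n \<omega> = 0" for m \<omega>
    using that by (induction m rule: dec_induct) (auto simp: lhat_Suc)
  have lm: "lhat n \<in> borel_measurable (P th)" unfolding measurable_cong_sets[OF sets_P refl] by (rule lhat_meas)
  then have Zm: "?Z \<in> sets (P th)" by measurable
  have sub: "?Z \<subseteq> bad0 th 1 (Suc m)" if "n \<le> m" for m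
  proof
    fix \<omega> assume "\<omega> \<in> ?Z"
    then have "\<omega> \<in> space (P th)" "lhat (Suc m) \<omega> = 0" using zero[of "Suc m" \<omega>] that by auto
    then show "\<omega> \<in> bad0 th 1 (Suc m)" by (simp add: bad0_def C_event_def Lhat_eq)
  qed
  have "(\<lambda>m. P.prob (bad0 th 1 (Suc m))) \<longlonglongrightarrow> 0"
    using bad_summable(1)[OF th, of 1] by (intro summable_LIMSEQ_zero) simp
  moreover have "\<forall>\<^sub>F m in sequentially. P.prob ?Z \<le> P.prob (bad0 th 1 (Suc m))"
    using sub bad_sets by (intro eventually_sequentiallyI[of n] P.finite_measure_mono) auto
  ultimately have "P.prob ?Z \<le> 0" by (intro tendsto_lowerbound) auto
  then have "emeasure (P th) ?Z = 0" by (simp add: P.emeasure_eq_measure measure_le_0_iff)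
  then have "AE \<omega> in P th. \<omega> \<notin> ?Z" using Zm by (intro AE_not_in null_setsI)
  then show ?thesis
    by (rule AE_mp) (use lhat_nonneg[of n] in \<open>auto intro!: AE_I2 simp: less_le\<close>)
qed

text \<open>If both separations are infinite, both ratios must eventually be infinite, so
  \<^term>\<open>L0 n \<omega>\<close> and \<^term>\<open>L1 n \<omega>\<close> vanish; but one of them dominates a nonzero constant competitor.\<close>
lemma no_both_infinite_dominated:
  assumes th: "th \<in> bold" and inf: "J0 th = \<infinity>" "J1 th = \<infinity>"
    and e: "e0 \<in> \<Theta>0" "e1 \<in> \<Theta>1"
    and pos: "\<And>k. k < K \<Longrightarrow> AE x in law (th k). f e0 x > 0" "\<And>k. k < K \<Longrightarrow> AE x in law (th k). f e1 x > 0"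
  shows False
proof -
  interpret P: prob_space "P th" using th bold_in by (intro P_prob) auto
  have "(\<lambda>n. P.prob (bad0 th 1 (Suc n)) + P.prob (bad1 th 1 (Suc n))) \<longlonglongrightarrow> 0 + 0"
    using bad_summable[OF th, of 1] by (intro tendsto_add summable_LIMSEQ_zero) auto
  then have "\<forall>\<^sub>F n in sequentially. P.prob (bad0 th 1 (Suc n)) + P.prob (bad1 th 1 (Suc n)) < 1"
    by (intro order_tendstoD(2)) auto
  then obtain n where n: "P.prob (bad0 th 1 (Suc n)) + P.prob (bad1 th 1 (Suc n)) < 1"
    by (auto simp: eventually_sequentially)
  let ?B = "bad0 th 1 (Suc n) \<union> bad1 th 1 (Suc n)"
  have "P.prob ?B < 1" using n measure_Un_le[OF bad_sets, of th 1 "Suc n" 1 "Suc n"] by simp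
  have "AE \<omega> in P th. Lvec K f (Suc n) (\<lambda>_. e0) \<omega> > 0" "AE \<omega> in P th. Lvec K f (Suc n) (\<lambda>_. e1) \<omega> > 0"
    using e th bold_in pos by (auto intro!: AE_Lvec_pos)
  then have ae: "AE \<omega> in P th. Lvec K f (Suc n) (\<lambda>_. e0) \<omega> > 0 \<and> Lvec K f (Suc n) (\<lambda>_. e1) \<omega> > 0" by simp
  have "\<exists>\<omega>\<in>space (P th). \<omega> \<notin> ?B \<and> Lvec K f (Suc n) (\<lambda>_. e0) \<omega> > 0 \<and> Lvec K f (Suc n) (\<lambda>_. e1) \<omega> > 0"
  proof (rule ccontr)
    assume "\<not> ?thesis"
    then have "AE \<omega> in P th. \<omega> \<in> ?B" by - (rule AE_mp[OF ae], rule AE_I2, auto)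
    then have "P.prob ?B = 1" using bad_sets by (subst P.prob_eq_1) auto
    with \<open>P.prob ?B < 1\<close> show False by simp
  qed
  then obtain \<omega> where w: "\<omega> \<in> space (P th)" "\<omega> \<notin> bad0 th 1 (Suc n)" "\<omega> \<notin> bad1 th 1 (Suc n)"
    "Lvec K f (Suc n) (\<lambda>_. e0) \<omega> > 0" "Lvec K f (Suc n) (\<lambda>_. e1) \<omega> > 0" by auto
  then have z: "L0 (Suc n) \<omega> = 0" "L1 (Suc n) \<omega> = 0"
    using inf by (auto simp: bad0_def bad1_def C_event_def intro: ratio_top_imp)
  have K0: "{..<K} \<noteq> {}" using K by (auto simp: lessThan_empty_iff)
  show False
  \<comment> \<open>If nothing is declared signal, the all-signal vector competes in
    \<open>L0\<close>; otherwise the all-noise vector competes in \<open>L1\<close>.\<close>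
  proof (cases "A (Suc n) \<omega> = {}")
    case True
    then show False
      using le_L0[of "\<lambda>_. e1" "Suc n" \<omega>] const_in_bold[of e1] e K0 z w by (auto simp: sig_const)
  next
    case False
    then show False
      using le_L1[of "\<lambda>_. e0" "Suc n" \<omega>] const_in_bold[of e0] e K0 z w by (auto simp: sig_const)
  qed
qed

text \<open>Union bound. Condition (C) starts at time 1; the remaining term at time 0 is finite as a
  probability.\<close>

lemma bad_cover_finite:
  assumes th: "th \<in> bold" and \<epsilon>: "\<epsilon> > 0"
    and sub: "\<And>n. n \<ge> 1 \<Longrightarrow> AE \<omega> in P th. \<omega> \<in> E n \<longrightarrow> \<omega> \<in> bad0 th \<epsilon> n \<union> bad1 th \<epsilon> n"
  shows "(\<Sum>n. emeasure (P th) (E n)) \<noteq> \<infinity>"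
proof -
  interpret P: prob_space "P th" using th bold_in by (intro P_prob) auto
  let ?q = "\<lambda>n. P.prob (bad0 th \<epsilon> (Suc n)) + P.prob (bad1 th \<epsilon> (Suc n))"
  have "emeasure (P th) (E (Suc n)) \<le> ennreal (?q n)" for n
  proof -
    have "emeasure (P th) (E (Suc n)) \<le> emeasure (P th) (bad0 th \<epsilon> (Suc n) \<union> bad1 th \<epsilon> (Suc n))"
      using sub[of "Suc n"] bad_sets by (intro emeasure_mono_AE) auto
    also have "\<dots> \<le> emeasure (P th) (bad0 th \<epsilon> (Suc n)) + emeasure (P th) (bad1 th \<epsilon> (Suc n))"
      by (intro emeasure_subadditive bad_sets)
    finally show ?thesis by (simp add: P.emeasure_eq_measure)
  qed
  then have "(\<Sum>n. emeasure (P th) (E (Suc n))) \<le> (\<Sum>n. ennreal (?q n))" by (intro suminf_le) auto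
  also have "\<dots> = ennreal (\<Sum>n. ?q n)"
    using bad_summable[OF th \<epsilon>] by (intro suminf_ennreal2 summable_add) auto
  finally have "(\<Sum>n. emeasure (P th) (E (Suc n))) \<noteq> \<infinity>" by (auto simp: top_unique)
  moreover have "(\<Sum>n. emeasure (P th) (E n)) = emeasure (P th) (E 0) + (\<Sum>n. emeasure (P th) (E (Suc n)))"
    using suminf_offset[of "\<lambda>n. emeasure (P th) (E n)" 1] by (simp add: add.commute)
  ultimately show ?thesis by simp
qed

text \<open>Needed for the final estimate: two infinite separations would make its right-hand side 0
  for all \<open>a\<close> and \<open>b\<close>, whereas the stopping time is at least 1.\<close>

lemma not_both_infinite:
  assumes th: "th \<in> bold"
  shows "J0 th \<noteq> \<infinity> \<or> J1 th \<noteq> \<infinity>"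
proof (rule ccontr)
  assume "\<not> ?thesis"
  then have inf: "J0 th = \<infinity>" "J1 th = \<infinity>" by auto
  \<comment> \<open>The estimate at time 0 looks at no observation, so any argument, here
    \<open>undefined\<close>, names it.\<close>
  define d where "d = thhat 0 0 undefined"
  have K0: "0 < K" using K by simp
  have d: "d \<in> \<Theta>0 \<union> \<Theta>1" unfolding d_def by (rule thhat_in) (rule K0)
  \<comment> \<open>At time 1 the plug-in likelihood contains the density of \<open>d\<close> at the
    first observation of stream 0; positivity under the constant vector \<open>\<theta>\<close>
    passes to this factor.\<close>
  have dpos: "AE x in law \<theta>. f d x > 0" if \<theta>: "\<theta> \<in> \<Theta>0 \<union> \<Theta>1" for \<theta>
  proof -
    have "AE \<omega> in P (\<lambda>_. \<theta>). f d (\<omega> (0, Suc 0)) > 0"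
    proof (rule AE_mp[OF lhat_pos[OF const_in_bold[OF \<theta>], of "Suc 0"]], rule AE_I2, rule impI)
      fix \<omega> assume "lhat (Suc 0) \<omega> > 0"
      then have "0 < (\<Prod>k<K. f (thhat k 0 (stream \<omega> k)) (\<omega> (k, Suc 0)))"
        by (simp add: lhat_def)
      then have "0 < f (thhat 0 0 (stream \<omega> 0)) (\<omega> (0, Suc 0))"
        by (rule prod_pos_imp_pos) (use K0 in \<open>auto intro!: f_nonneg thhat_in\<close>)
      moreover have "thhat 0 0 (stream \<omega> 0) = d" unfolding d_def using K0 by (intro thhat_cong) auto
      ultimately show "f d (\<omega> (0, Suc 0)) > 0" by simp
    qed
    then show ?thesis using AE_P_component[where th="\<lambda>_. \<theta>" and k=0 and \<theta>=d and t="Suc 0"] \<theta> d K0 by blast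
  qed
  have ac: "absolutely_continuous (law d) (law \<theta>)" if \<theta>: "\<theta> \<in> \<Theta>0 \<union> \<Theta>1" for \<theta>
    unfolding absolutely_continuous_def
  proof
    fix N assume "N \<in> null_sets (law d)"
    then have N: "N \<in> sets \<nu>" "AE x in \<nu>. x \<in> N \<longrightarrow> ennreal (f d x) = 0"
      using f_meas[OF d] unfolding law_def by (auto simp: null_sets_density_iff)
    have "AE x in \<nu>. 0 < ennreal (f \<theta> x) \<longrightarrow> f d x > 0"
      using dpos[OF \<theta>] f_meas[OF \<theta>] unfolding law_def by (subst (asm) AE_density) auto
    with N(2) have "AE x in \<nu>. x \<in> N \<longrightarrow> ennreal (f \<theta> x) = 0"
      by eventually_elim (auto simp: ennreal_eq_0_iff zero_less_iff_neq_zero not_le)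
    with N(1) show "N \<in> null_sets (law \<theta>)"
      using f_meas[OF \<theta>] unfolding law_def by (auto simp: null_sets_density_iff)
  qed
  \<comment> \<open>By \<open>ac\<close>, positivity \<open>d\<close>-almost everywhere passes to
    every law of the family, so members of \<open>D\<close> give nonvanishing competitors under any
    truth.\<close>
  define D where "D = {\<theta> \<in> \<Theta>0 \<union> \<Theta>1. AE x in law d. f \<theta> x > 0}"
  have Dpos: "AE x in law \<theta>. f e x > 0" if "e \<in> D" "\<theta> \<in> \<Theta>0 \<union> \<Theta>1" for e \<theta>
    using that ac[OF that(2)] unfolding D_def by (auto intro: absolutely_continuous_AE[of "law \<theta>" "law d"])
  have dD: "d \<in> D" using d dpos[OF d] by (simp add: D_def)
  have usedD: "AE \<omega> in P (\<lambda>_. p). \<forall>k<K. thhat k n (stream \<omega> k) \<in> D" if p: "p \<in> \<Theta>0 \<union> \<Theta>1" for p n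
    by (rule AE_mp[OF thhat_dominates[OF p d ac[OF p] lhat_pos[OF const_in_bold[OF d]]]], rule AE_I2)
       (use thhat_in in \<open>auto simp: D_def\<close>)
  have selfpos: "AE x in law p. f p x > 0" if "p \<in> \<Theta>0 \<union> \<Theta>1" for p
    unfolding law_def using f_meas[OF that] by (subst AE_density) auto
  have constpos: "AE \<omega> in P (\<lambda>_. p). Lvec K f n (\<lambda>_. p) \<omega> > 0" if "p \<in> \<Theta>0 \<union> \<Theta>1" for p n
    using that selfpos[OF that] by (intro AE_Lvec_pos) auto
  have ratio: "Lhat K f thhat n \<omega> / B \<le> ennreal c"
    if "lhat n \<omega> < c * l" "0 < l" "ennreal l \<le> B" for n \<omega> B c l
  proof -
    have "0 < c * l" using that lhat_nonneg[of n \<omega>] by linarith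
    then have c: "c > 0" using that(2) by (simp add: zero_less_mult_iff)
    have "Lhat K f thhat n \<omega> \<le> ennreal (c * l)" using that by (simp add: Lhat_eq ennreal_leI)
    also have "\<dots> = ennreal c * ennreal l" using c by (simp add: ennreal_mult')
    also have "\<dots> \<le> ennreal c * B" using that by (intro mult_left_mono) auto
    finally have "Lhat K f thhat n \<omega> \<le> B * ennreal c" by (simp add: mult.commute)
    moreover have "0 < B" using that(2,3) by (meson ennreal_less_zero_iff less_le_trans)
    ultimately show ?thesis by (intro divide_le_posI_ennreal)
  qed
  \<comment> \<open>With tolerance \<open>J / 2\<close> and separation at least \<open>J\<close>,
    the rate demanded by (C) is at least \<open>J / 2\<close>.\<close>
  have bound: "ennreal (exp (real n * (J / 2))) \<le> ennreal (exp (real n * (real_of_ereal i - J / 2)))"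
    if "ereal J \<le> i" "i \<noteq> \<infinity>" for n J i
  proof -
    obtain r where r: "i = ereal r" "J \<le> r" using \<open>ereal J \<le> i\<close> \<open>i \<noteq> \<infinity>\<close> by (cases i) simp_all
    then have "J / 2 \<le> r - J / 2" by simp
    then have "real n * (J / 2) \<le> real n * (r - J / 2)" by (intro mult_left_mono) auto
    then show ?thesis by (simp add: r(1) ennreal_leI)
  qed
  consider (both) e0 e1 where "e0 \<in> D" "e0 \<in> \<Theta>0" "e1 \<in> D" "e1 \<in> \<Theta>1" | (noise) "D \<subseteq> \<Theta>0" | (signal) "D \<subseteq> \<Theta>1"
    unfolding D_def by blast
  then show False
  proof cases
    case both
    show False
      by (rule no_both_infinite_dominated[OF th inf both(2,4)]) (use Dpos both th bold_in in blast)+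
  next
    case noise
    obtain p where p: "p \<in> \<Theta>1" using ne1 by auto
    then have pT: "p \<in> \<Theta>0 \<union> \<Theta>1" by auto
    note pb = const_in_bold[OF pT]
    have le: "(INF s\<in>\<Theta>0. KL \<nu> f p s) \<le> J1 (\<lambda>_. p)" by (intro I1_lower pb) auto
    \<comment> \<open>All streams carry signal, so \<open>J0\<close> is infinite. Were
      \<open>J1\<close> infinite too, \<open>d\<close> as noise and \<open>p\<close> itself as
      signal would be two nonvanishing competitors.\<close>
    have "J1 (\<lambda>_. p) \<noteq> \<infinity>"
      using no_both_infinite_dominated[OF pb I_const_infinite(1)[OF p] _ _ p, of d] noise dD dpos[OF pT] selfpos[OF pT] by blast
    then obtain J where J: "(INF s\<in>\<Theta>0. KL \<nu> f p s) = ereal J" "J > 0"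
      using sep1[OF p] le by (cases "INF s\<in>\<Theta>0. KL \<nu> f p s") auto
    show False
    proof (rule competitor_side_absurd[OF pT _ _ lhat_pos[OF pb] J])
      show "\<Theta>0 \<subseteq> \<Theta>0 \<union> \<Theta>1" by auto
      show "AE \<omega> in P (\<lambda>_. p). \<forall>k<K. thhat k n (stream \<omega> k) \<in> \<Theta>0" for n
        by (rule AE_mp[OF usedD[OF pT, of n]], rule AE_I2) (use noise in auto)
      fix q assume q: "q \<in> \<Theta>0" "AE x in law p. f q x > 0"
      \<comment> \<open>Only stream 0 becomes noise. One noise value \<open>q\<close> and one signal
        value \<open>p\<close> keep the vector in \<open>bold\<close>.\<close>
      let ?c = "\<lambda>k::nat. if k = 0 then q else p"
      have cb: "?c \<in> bold"
      proof -
        have "\<forall>k<K. ?c k \<in> \<Theta>0 \<union> \<Theta>1" using q p by auto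
        moreover have "\<forall>k<K. (?c k \<in> \<Theta>0 \<longrightarrow> ?c k = q) \<and> (?c k \<in> \<Theta>1 \<longrightarrow> ?c k = p)" using q p disj by auto
        ultimately show ?thesis using q(1) p unfolding Theta_bold_def by blast
      qed
      have cpos: "AE \<omega> in P (\<lambda>_. p). Lvec K f n ?c \<omega> > 0" for n
        using pT q selfpos[OF pT] by (intro AE_Lvec_pos) auto
      show "(\<Sum>n. emeasure (P (\<lambda>_. p)) {\<omega> \<in> space (P (\<lambda>_. p)). lhat n \<omega> < exp (real n * (J / 2)) * Lvec K f n ?c \<omega>}) \<noteq> \<infinity>"
      proof (rule bad_cover_finite[OF pb])
        show "J / 2 > 0" using J by simp
        show "AE \<omega> in P (\<lambda>_. p). \<omega> \<in> {\<omega> \<in> space (P (\<lambda>_. p)). lhat n \<omega> < exp (real n * (J / 2)) * Lvec K f n ?c \<omega>}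
            \<longrightarrow> \<omega> \<in> bad0 (\<lambda>_. p) (J / 2) n \<union> bad1 (\<lambda>_. p) (J / 2) n" for n
        proof (rule AE_mp[OF cpos[of n]], rule AE_mp[OF constpos[OF pT, of n]], rule AE_I2, intro impI)
          fix \<omega> assume l: "Lvec K f n (\<lambda>_. p) \<omega> > 0" "Lvec K f n ?c \<omega> > 0"
            and "\<omega> \<in> {\<omega> \<in> space (P (\<lambda>_. p)). lhat n \<omega> < exp (real n * (J / 2)) * Lvec K f n ?c \<omega>}"
          then have w: "\<omega> \<in> space (P (\<lambda>_. p))" "lhat n \<omega> < exp (real n * (J / 2)) * Lvec K f n ?c \<omega>" by auto
          show "\<omega> \<in> bad0 (\<lambda>_. p) (J / 2) n \<union> bad1 (\<lambda>_. p) (J / 2) n"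
          \<comment> \<open>If all streams are declared signal, \<open>?c\<close> competes in
            \<open>L1\<close> and keeps that ratio too small. Otherwise the truth itself competes in
            \<open>L0\<close>, so that ratio is finite although \<open>J0\<close> is
            infinite.\<close>
          proof (cases "A n \<omega> = {..<K}")
            case True
            have "A n \<omega> - sig ?c \<noteq> {}" using True K0 q disj by (auto simp: signal_set_def)
            then have "ennreal (Lvec K f n ?c \<omega>) \<le> L1 n \<omega>" by (rule le_L1[OF cb])
            then have "Lhat K f thhat n \<omega> / L1 n \<omega> \<le> ennreal (exp (real n * (J / 2)))"
              by (rule ratio[OF w(2) l(2)])
            then have "Lhat K f thhat n \<omega> / L1 n \<omega> \<le> ennreal (exp (real n * (real_of_ereal (J1 (\<lambda>_. p)) - J / 2)))"
              by (rule order_trans[OF _ bound[OF le[unfolded J(1)] \<open>J1 (\<lambda>_. p) \<noteq> \<infinity>\<close>]])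
            then have "\<omega> \<in> bad1 (\<lambda>_. p) (J / 2) n"
              using w(1) \<open>J1 (\<lambda>_. p) \<noteq> \<infinity>\<close> unfolding bad1_def C_event_def by simp
            then show ?thesis by simp
          next
            case False
            then have "sig (\<lambda>_. p) - A n \<omega> \<noteq> {}" using A_subset[of n \<omega>] p by (auto simp: sig_const)
            then have "ennreal (Lvec K f n (\<lambda>_. p) \<omega>) \<le> L0 n \<omega>" by (intro le_L0 pb)
            then have "L0 n \<omega> \<noteq> 0" using l by auto
            then have "\<omega> \<in> bad0 (\<lambda>_. p) (J / 2) n"
              using w(1) ratio_top_imp[of n \<omega> "L0 n \<omega>"] I_const_infinite(1)[OF p] unfolding bad0_def C_event_def by auto
            then show ?thesis by simp
          qed
        qed
      qed
    qed
  next
    \<comment> \<open>Mirror image: noise and signal, \<open>L0\<close> and \<open>L1\<close>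
      exchange roles, and the decisive declaration is the empty set.\<close>
    case signal
    obtain p where p: "p \<in> \<Theta>0" using ne0 by auto
    then have pT: "p \<in> \<Theta>0 \<union> \<Theta>1" by auto
    note pb = const_in_bold[OF pT]
    have le: "(INF s\<in>\<Theta>1. KL \<nu> f p s) \<le> J0 (\<lambda>_. p)" by (intro I0_lower pb) auto
    have "J0 (\<lambda>_. p) \<noteq> \<infinity>"
      using no_both_infinite_dominated[OF pb _ I_const_infinite(2)[OF p] p, of d] signal dD dpos[OF pT] selfpos[OF pT] by blast
    then obtain J where J: "(INF s\<in>\<Theta>1. KL \<nu> f p s) = ereal J" "J > 0"
      using sep0[OF p] le by (cases "INF s\<in>\<Theta>1. KL \<nu> f p s") auto
    show False
    proof (rule competitor_side_absurd[OF pT _ _ lhat_pos[OF pb] J])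
      show "\<Theta>1 \<subseteq> \<Theta>0 \<union> \<Theta>1" by auto
      show "AE \<omega> in P (\<lambda>_. p). \<forall>k<K. thhat k n (stream \<omega> k) \<in> \<Theta>1" for n
        by (rule AE_mp[OF usedD[OF pT, of n]], rule AE_I2) (use signal in auto)
      fix q assume q: "q \<in> \<Theta>1" "AE x in law p. f q x > 0"
      let ?c = "\<lambda>k::nat. if k = 0 then q else p"
      have cb: "?c \<in> bold"
      proof -
        have "\<forall>k<K. ?c k \<in> \<Theta>0 \<union> \<Theta>1" using q p by auto
        moreover have "\<forall>k<K. (?c k \<in> \<Theta>0 \<longrightarrow> ?c k = p) \<and> (?c k \<in> \<Theta>1 \<longrightarrow> ?c k = q)" using q p disj by auto
        ultimately show ?thesis using q(1) p unfolding Theta_bold_def by blast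
      qed
      have cpos: "AE \<omega> in P (\<lambda>_. p). Lvec K f n ?c \<omega> > 0" for n
        using pT q selfpos[OF pT] by (intro AE_Lvec_pos) auto
      show "(\<Sum>n. emeasure (P (\<lambda>_. p)) {\<omega> \<in> space (P (\<lambda>_. p)). lhat n \<omega> < exp (real n * (J / 2)) * Lvec K f n ?c \<omega>}) \<noteq> \<infinity>"
      proof (rule bad_cover_finite[OF pb])
        show "J / 2 > 0" using J by simp
        show "AE \<omega> in P (\<lambda>_. p). \<omega> \<in> {\<omega> \<in> space (P (\<lambda>_. p)). lhat n \<omega> < exp (real n * (J / 2)) * Lvec K f n ?c \<omega>}
            \<longrightarrow> \<omega> \<in> bad0 (\<lambda>_. p) (J / 2) n \<union> bad1 (\<lambda>_. p) (J / 2) n" for n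
        proof (rule AE_mp[OF cpos[of n]], rule AE_mp[OF constpos[OF pT, of n]], rule AE_I2, intro impI)
          fix \<omega> assume l: "Lvec K f n (\<lambda>_. p) \<omega> > 0" "Lvec K f n ?c \<omega> > 0"
            and "\<omega> \<in> {\<omega> \<in> space (P (\<lambda>_. p)). lhat n \<omega> < exp (real n * (J / 2)) * Lvec K f n ?c \<omega>}"
          then have w: "\<omega> \<in> space (P (\<lambda>_. p))" "lhat n \<omega> < exp (real n * (J / 2)) * Lvec K f n ?c \<omega>" by auto
          show "\<omega> \<in> bad0 (\<lambda>_. p) (J / 2) n \<union> bad1 (\<lambda>_. p) (J / 2) n"
          proof (cases "A n \<omega> = {}")
            case True
            have "sig ?c - A n \<omega> \<noteq> {}" using True K0 q by (auto simp: signal_set_def)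
            then have "ennreal (Lvec K f n ?c \<omega>) \<le> L0 n \<omega>" by (rule le_L0[OF cb])
            then have "Lhat K f thhat n \<omega> / L0 n \<omega> \<le> ennreal (exp (real n * (J / 2)))"
              by (rule ratio[OF w(2) l(2)])
            then have "Lhat K f thhat n \<omega> / L0 n \<omega> \<le> ennreal (exp (real n * (real_of_ereal (J0 (\<lambda>_. p)) - J / 2)))"
              by (rule order_trans[OF _ bound[OF le[unfolded J(1)] \<open>J0 (\<lambda>_. p) \<noteq> \<infinity>\<close>]])
            then have "\<omega> \<in> bad0 (\<lambda>_. p) (J / 2) n"
              using w(1) \<open>J0 (\<lambda>_. p) \<noteq> \<infinity>\<close> unfolding bad0_def C_event_def by simp
            then show ?thesis by simp
          next
            case False
            then have "A n \<omega> - sig (\<lambda>_. p) \<noteq> {}" using p by (auto simp: sig_const)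
            then have "ennreal (Lvec K f n (\<lambda>_. p) \<omega>) \<le> L1 n \<omega>" by (intro le_L1 pb)
            then have "L1 n \<omega> \<noteq> 0" using l by auto
            then have "\<omega> \<in> bad1 (\<lambda>_. p) (J / 2) n"
              using w(1) ratio_top_imp[of n \<omega> "L1 n \<omega>"] I_const_infinite(2)[OF p] unfolding bad1_def C_event_def by auto
            then show ?thesis by simp
          qed
        qed
      qed
    qed
  qed
qed

end

section \<open>The stopping time\<close>

context streams_test
begin

text \<open>\<open>R\<close> fails the inequality that defines a bad event. For finite
  \<open>I\<close> the tolerance leaves the rate \<open>I / c\<close>, so \<open>R\<close> exceeds
  \<open>exp (n * I / c)\<close>, and \<open>n \<ge> c * ln b / I\<close> lifts this to
  \<open>b\<close>.\<close>

lemma threshold_le_ratio: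
  fixes R :: ennreal and I :: ereal
  assumes R: "\<not> (if I = \<infinity> then R \<noteq> \<top> else R \<le> ennreal (exp (real n * (real_of_ereal I - e))))"
    and e: "I \<noteq> \<infinity> \<Longrightarrow> real_of_ereal I - e = real_of_ereal I / c"
    and I: "I > 0" and c: "c > 0" and b: "b > 0" and n: "c * div_inf (ln b) I \<le> real n"
  shows "ennreal b \<le> R"
proof (cases "I = \<infinity>")
  case False
  then obtain r where r: "I = ereal r" "r > 0" using I by (cases I) auto
  have "c * (ln b / r) \<le> real n" using n r by (simp add: div_inf_def)
  then have "ln b \<le> real n * (r / c)" using r c by (simp add: field_simps)
  then have "exp (ln b) \<le> exp (real n * (r / c))" by (simp only: exp_le_cancel_iff)
  then have "ennreal b \<le> ennreal (exp (real n * (real_of_ereal I - e)))"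
    using e b r by (simp add: ennreal_leI)
  also have "\<dots> \<le> R" using R False by (simp add: not_le less_imp_le)
  finally show ?thesis .
qed (use R in simp)

text \<open>Every time from \<open>m\<close> until just before stopping is bad, so the delay beyond
  \<open>m\<close> is at most the number of bad times.\<close>

lemma stop_time_le_count:
  assumes "\<And>n. n \<ge> m \<Longrightarrow> \<omega> \<notin> B n \<Longrightarrow> stop_cond K f \<Theta>0 \<Theta>1 thhat a b n \<omega>" and m: "m \<ge> 1"
  shows "That K f \<Theta>0 \<Theta>1 thhat a b \<omega> \<le> of_nat m + (\<Sum>n. indicator (B (Suc n)) \<omega>)"
proof -
  let ?S = "\<Sum>n. indicator (B (Suc n)) \<omega> :: ennreal"
  let ?stop = "\<lambda>n. stop_cond K f \<Theta>0 \<Theta>1 thhat a b n \<omega>"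
  have count: "of_nat N \<le> of_nat m + ?S" if "\<And>n. n \<ge> 1 \<Longrightarrow> n < N \<Longrightarrow> \<not> ?stop n" for N
  proof (cases "N \<le> m")
    case True
    then have "(of_nat N :: ennreal) \<le> of_nat m" by simp
    then show ?thesis by (rule order_trans) simp
  next
    case False
    \<comment> \<open>The sum begins with \<open>B 1\<close>, so the times from \<open>m\<close> to
      \<open>N - 1\<close> appear with indices lower by one.\<close>
    have "indicator (B (Suc n)) \<omega> = (1 :: ennreal)" if "n \<in> {m - 1..<N - 1}" for n
    proof -
      have "m \<le> Suc n" "Suc n < N" using that by auto
      then show ?thesis
        using assms(1)[of "Suc n"] \<open>\<And>n. n \<ge> 1 \<Longrightarrow> n < N \<Longrightarrow> \<not> ?stop n\<close>[of "Suc n"] by (auto simp: indicator_def)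
    qed
    then have "(\<Sum>n\<in>{m - 1..<N - 1}. indicator (B (Suc n)) \<omega>) = (of_nat (N - m) :: ennreal)"
      using m by simp
    then have "of_nat (N - m) \<le> ?S"
      using sum_le_suminf[of "\<lambda>n. indicator (B (Suc n)) \<omega> :: ennreal" "{m - 1..<N - 1}"] by simp
    then have "of_nat m + of_nat (N - m) \<le> of_nat m + ?S" by (rule add_left_mono)
    then show ?thesis using False by (simp flip: of_nat_add)
  qed
  show ?thesis
  proof (cases "\<exists>n\<ge>1. ?stop n")
    case True
    define \<tau> where "\<tau> = (LEAST n. n \<ge> 1 \<and> ?stop n)"
    have "\<not> ?stop n" if "n \<ge> 1" "n < \<tau>" for n
      using not_less_Least[of n "\<lambda>n. n \<ge> 1 \<and> ?stop n"] that unfolding \<tau>_def by blast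
    then show ?thesis using count[of \<tau>] True by (simp add: That_def \<tau>_def)
  next
    case False
    \<comment> \<open>If the rule is never met, every \<open>N\<close> bounds the count from below;
      the count is infinite, in accordance with \<open>That\<close>.\<close>
    then have all: "of_nat N \<le> of_nat m + ?S" for N by (intro count) blast
    have "of_nat m + ?S = \<top>"
    proof (rule ccontr)
      assume "of_nat m + ?S \<noteq> \<top>"
      then obtain N where "of_nat m + ?S < of_nat N" using ennreal_Ex_less_of_nat[of "of_nat m + ?S"] unfolding less_top by blast
      with all[of N] show False by (simp add: leD)
    qed
    then show ?thesis by simp
  qed
qed

lemma expected_stop_time_bound:
  assumes th: "th \<in> bold" and \<epsilon>: "\<epsilon> > 0"
  shows "\<exists>a0 b0. \<forall>a b. a \<ge> a0 \<and> b \<ge> b0 \<longrightarrow>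
     (\<integral>\<^sup>+ \<omega>. That K f \<Theta>0 \<Theta>1 thhat a b \<omega> \<partial>P th)
       \<le> ennreal ((1 + \<epsilon>) * max (div_inf (ln b) (J0 th)) (div_inf (ln a) (J1 th)))"
proof -
  interpret P: prob_space "P th" using th bold_in by (intro P_prob) auto
  note I_pos = I_pos[OF th]
  \<comment> \<open>Half of \<open>\<epsilon>\<close> pays for the slower rate \<open>I / c\<close>,
    the other half for the additive terms.\<close>
  define c where "c = 1 + \<epsilon> / 2"
  have c: "c > 1" using \<epsilon> by (simp add: c_def)
  \<comment> \<open>The tolerance that leaves the rate \<open>I / c\<close>. Condition (C) asks for
    a positive one, so 1 serves when \<open>I\<close> is infinite.\<close>
  define e where "e I = (if I = \<infinity> then 1 else real_of_ereal I - real_of_ereal I / c)" for I :: ereal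
  have e_pos: "e I > 0" if "I > 0" for I
    using that c by (cases I) (auto simp: e_def field_simps)
  have e_eq: "I \<noteq> \<infinity> \<Longrightarrow> real_of_ereal I - e I = real_of_ereal I / c" for I by (simp add: e_def)
  define B where "B n = bad0 th (e (J0 th)) n \<union> bad1 th (e (J1 th)) n" for n
  have B_sets[measurable]: "B n \<in> sets (P th)" for n unfolding B_def by (intro sets.Un bad_sets)
  let ?q = "\<lambda>n. P.prob (bad0 th (e (J0 th)) (Suc n)) + P.prob (bad1 th (e (J1 th)) (Suc n))"
  define s where "s = (\<Sum>n. ?q n)"
  have sm: "summable ?q" using bad_summable[OF th] e_pos I_pos by (intro summable_add) auto
  have s0: "s \<ge> 0" unfolding s_def using sm by (intro suminf_nonneg) auto
  have Bs: "(\<Sum>n. emeasure (P th) (B (Suc n))) \<le> ennreal s"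
  proof -
    have "emeasure (P th) (B (Suc n)) \<le> ennreal (?q n)" for n
      unfolding B_def using emeasure_subadditive[OF bad_sets, of th "e (J0 th)" "Suc n" "e (J1 th)" "Suc n"]
      by (simp add: P.emeasure_eq_measure)
    then have "(\<Sum>n. emeasure (P th) (B (Suc n))) \<le> (\<Sum>n. ennreal (?q n))" by (intro suminf_le) auto
    also have "\<dots> = ennreal s" unfolding s_def using sm by (intro suminf_ennreal2) auto
    finally show ?thesis .
  qed
  \<comment> \<open>Once the maximum \<open>X\<close> is at least \<open>t\<close>,
    \<open>\<epsilon> / 2 * X\<close> absorbs the bound \<open>s\<close> on the expected number of
    bad times and the 2 lost in rounding up to \<open>m\<close>.\<close>
  define t where "t = 2 * (s + 2) / \<epsilon>"
  have t: "t \<ge> 0" "\<epsilon> / 2 * t = s + 2" using s0 \<epsilon> by (auto simp: t_def)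
  \<comment> \<open>For finite \<open>I\<close>, \<open>ln y / I\<close> is at least
    \<open>t\<close> from \<open>x0 I\<close> on. The maximum with 1 below keeps the thresholds
    positive.\<close>
  define x0 where "x0 I = exp (real_of_ereal I * t)" for I :: ereal
  have bound: "(\<integral>\<^sup>+ \<omega>. That K f \<Theta>0 \<Theta>1 thhat a b \<omega> \<partial>P th)
       \<le> ennreal ((1 + \<epsilon>) * max (div_inf (ln b) (J0 th)) (div_inf (ln a) (J1 th)))"
    if a: "a \<ge> max 1 (x0 (J1 th))" and b: "b \<ge> max 1 (x0 (J0 th))" for a b
  proof -
    define X where "X = max (div_inf (ln b) (J0 th)) (div_inf (ln a) (J1 th))"
    have large: "t \<le> div_inf (ln y) I" if "I > 0" "I \<noteq> \<infinity>" "y \<ge> max 1 (x0 I)" for y I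
    proof -
      obtain r where r: "I = ereal r" "r > 0" using \<open>I > 0\<close> \<open>I \<noteq> \<infinity>\<close> by (cases I) simp_all
      have "ln (exp (r * t)) \<le> ln y" using that(3) r by (subst ln_le_cancel_iff) (auto simp: x0_def)
      then show ?thesis using r by (simp add: div_inf_def field_simps)
    qed
    \<comment> \<open>\<open>not_both_infinite\<close> enters here: at least one of the two terms is
      a genuine quotient and therefore grows.\<close>
    have Xt: "t \<le> X"
      using not_both_infinite[OF th] large[OF I_pos(1) _ b] large[OF I_pos(2) _ a] by (auto simp: X_def le_max_iff_disj)
    have X0: "X \<ge> 0" using Xt t by simp
    define m where "m = Suc (nat \<lceil>c * X\<rceil>)"
    have m: "real m \<le> c * X + 2" "c * X \<le> real m" unfolding m_def using X0 c by (auto, linarith+)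
    have stop: "stop_cond K f \<Theta>0 \<Theta>1 thhat a b n \<omega>"
      if "n \<ge> m" "\<omega> \<notin> B n" "\<omega> \<in> space (P th)" for n \<omega>
    proof -
      have "c * X \<le> real n" using m(2) that(1) by linarith
      then have n: "c * div_inf (ln b) (J0 th) \<le> real n" "c * div_inf (ln a) (J1 th) \<le> real n"
        using c by (auto simp: X_def intro: order_trans[rotated])
      have "ennreal b \<le> Lhat K f thhat n \<omega> / L0 n \<omega>"
        by (rule threshold_le_ratio[OF _ e_eq I_pos(1) _ _ n(1)])
           (use that b c in \<open>auto simp: B_def bad0_def C_event_def\<close>)
      moreover have "ennreal a \<le> Lhat K f thhat n \<omega> / L1 n \<omega>"
        by (rule threshold_le_ratio[OF _ e_eq I_pos(2) _ _ n(2)])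
           (use that a c in \<open>auto simp: B_def bad1_def C_event_def\<close>)
      ultimately show ?thesis by (simp add: stop_cond_def)
    qed
    have "(\<integral>\<^sup>+ \<omega>. That K f \<Theta>0 \<Theta>1 thhat a b \<omega> \<partial>P th)
        \<le> (\<integral>\<^sup>+ \<omega>. of_nat m + (\<Sum>n. indicator (B (Suc n)) \<omega>) \<partial>P th)"
      by (intro nn_integral_mono stop_time_le_count stop) (auto simp: m_def)
    also have "\<dots> = of_nat m + (\<Sum>n. emeasure (P th) (B (Suc n)))"
      by (simp add: nn_integral_add nn_integral_suminf P.emeasure_space_1)
    also have "\<dots> \<le> of_nat m + ennreal s" by (intro add_left_mono Bs)
    also have "\<dots> = ennreal (real m + s)" using s0 by (simp add: ennreal_of_nat_eq_real_of_nat)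
    also have "\<dots> \<le> ennreal ((1 + \<epsilon>) * X)"
    proof (rule ennreal_leI)
      have "\<epsilon> / 2 * t \<le> \<epsilon> / 2 * X" using Xt \<epsilon> by (intro mult_left_mono) auto
      then have "s + 2 \<le> \<epsilon> / 2 * X" using t by simp
      then show "real m + s \<le> (1 + \<epsilon>) * X" using m(1) by (simp add: c_def algebra_simps)
    qed
    finally show ?thesis unfolding X_def .
  qed
  then show ?thesis by blast
qed

end

theorem theorem3:
  fixes K :: nat and \<nu> :: "'x measure" and f :: "'p \<Rightarrow> 'x \<Rightarrow> real"
    and \<Theta>0 \<Theta>1 :: "'p set" and thhat :: "nat \<Rightarrow> nat \<Rightarrow> (nat \<Rightarrow> 'x) \<Rightarrow> 'p"
  assumes K: "K \<ge> 1"
    and sfin: "sigma_finite_measure \<nu>"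
    and ne0: "\<Theta>0 \<noteq> {}" and ne1: "\<Theta>1 \<noteq> {}" and disj: "\<Theta>0 \<inter> \<Theta>1 = {}"
    and dens: "\<And>th. th \<in> \<Theta>0 \<union> \<Theta>1 \<Longrightarrow>
                 f th \<in> borel_measurable \<nu> \<and> (\<forall>x. f th x \<ge> 0) \<and>
                 (\<integral>\<^sup>+ x. ennreal (f th x) \<partial>\<nu>) = 1"
    and sep0: "\<And>t0. t0 \<in> \<Theta>0 \<Longrightarrow> (INF t\<in>\<Theta>1. KL \<nu> f t0 t) > 0"
    and sep1: "\<And>t1. t1 \<in> \<Theta>1 \<Longrightarrow> (INF t\<in>\<Theta>0. KL \<nu> f t1 t) > 0"
    and mle: "near_MLE K f \<Theta>0 \<Theta>1 thhat"
    and meas: "\<And>th n. th \<in> Theta_bold K \<Theta>0 \<Theta>1 \<Longrightarrow>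
                 Lhat K f thhat n \<in> borel_measurable (Pth K \<nu> f th) \<and>
                 Lbold0 K f \<Theta>0 \<Theta>1 n \<in> borel_measurable (Pth K \<nu> f th) \<and>
                 Lbold1 K f \<Theta>0 \<Theta>1 n \<in> borel_measurable (Pth K \<nu> f th)"
    and C: "cond_C K \<nu> f \<Theta>0 \<Theta>1 thhat"
  shows "\<forall>th\<in>Theta_bold K \<Theta>0 \<Theta>1. \<forall>\<epsilon>>0. \<exists>a0 b0. \<forall>a b. a \<ge> a0 \<and> b \<ge> b0 \<longrightarrow>
           (\<integral>\<^sup>+ \<omega>. That K f \<Theta>0 \<Theta>1 thhat a b \<omega> \<partial>Pth K \<nu> f th)
             \<le> ennreal ((1 + \<epsilon>) * max (div_inf (ln b) (I0 K \<nu> f \<Theta>0 \<Theta>1 th))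
                                         (div_inf (ln a) (I1 K \<nu> f \<Theta>0 \<Theta>1 th)))"
proof -
  have sP: "sets (Pth K \<nu> f th) = sets (PiM ({..<K} \<times> UNIV) (\<lambda>_. \<nu>))" for th
    unfolding Pth_def by (intro sets_PiM_cong) auto
  \<comment> \<open>All parameters share one sigma-algebra, so measurability under a single vector,
    here constant noise, gives it on the product of \<open>\<nu>\<close>.\<close>
  obtain t0 where t0: "t0 \<in> \<Theta>0" using ne0 by auto
  then have "(\<lambda>_. t0) \<in> Theta_bold K \<Theta>0 \<Theta>1" using ne1 disj by (auto simp: Theta_bold_def)
  note m = meas[OF this, unfolded measurable_cong_sets[OF sP refl]]
  interpret streams_test K \<nu> f \<Theta>0 \<Theta>1 thhat
  proof
    show "1 \<le> K" by (rule K)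
    show "prob_density \<nu> (f \<theta>)" if "\<theta> \<in> \<Theta>0 \<union> \<Theta>1" for \<theta>
      using dens[OF that] by (simp add: prob_density_def)
    show "thhat k n x \<in> \<Theta>0 \<union> \<Theta>1" if "k < K" for k n x
      using mle that by (simp add: near_MLE_def)
    show "thhat k n x = thhat k n y" if "k < K" "\<And>t. t \<in> {1..n} \<Longrightarrow> x t = y t" for k n x y
      using mle that unfolding near_MLE_def by blast
  qed (use m ne0 ne1 disj sep0 sep1 C in blast)+
  show ?thesis using expected_stop_time_bound by blast
qed

end
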